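(* Let $m>1$ be an integer. There is no nonconstant homogeneous harmonic polynomial mapping $P:\mathbb{R}^3\to\mathbb{R}^3$ of degree $m$ which is quasiregular. More precisely, there is no homogeneous harmonic polynomial mapping $P:\mathbb{R}^3\to\mathbb{R}^3$ of degree $m$ whose Jacobian $J_P$ is strictly positive on $S^2$. Likewise, there is none whose Jacobian is strictly negative on $S^2$.
   Context: $S^2$ is the unit sphere of $\mathbb{R}^3$, $J_P=\det DP$. A homogeneous harmonic polynomial mapping of degree $m$ is a map all of whose components are homogeneous polynomials of degree $m$ that are harmonic (Euclidean Laplacian). A nonconstant mapping $f:\Omega\to\mathbb{R}^n$ on a domain $\Omega\subset\mathbb{R}^n$ is sense-preserving $K$-quasiregular if $f\in W^{1,n}_{\mathrm{loc}}(\Omega,\mathbb{R}^n)$, $J_f\ge0$ a.e. and $\|Df(x)\|^n\le KJ_f(x)$ for a.e. $x\in\Omega$ (operator norm). Here "quasiregular" means that $P$, or its composition with a reflection of the target, is sense-preserving $K$-quasiregular for some finite $K$. *)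

theory Defs
  imports "HOL-Analysis.Analysis"
begin

definition partial_derivative :: "'n \<Rightarrow> (real^'n \<Rightarrow> real) \<Rightarrow> real^'n::finite \<Rightarrow> real" where
  "partial_derivative i f x = frechet_derivative f (at x) (axis i 1)"

definition laplacian :: "(real^'n \<Rightarrow> real) \<Rightarrow> real^'n::finite \<Rightarrow> real" where
  "laplacian f x = (\<Sum>i\<in>UNIV. partial_derivative i (partial_derivative i f) x)"

text \<open>Formal sums of monomials \<open>x\<^sup>\<alpha>\<close> over multi-indices \<open>\<alpha>\<close> with \<open>\<bar>\<alpha>\<bar> = m\<close>;
  the zero polynomial is homogeneous of every degree.\<close>

definition homogeneous_polynomial :: "nat \<Rightarrow> (real^'n::finite \<Rightarrow> real) \<Rightarrow> bool" where
  "homogeneous_polynomial m p \<longleftrightarrow>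
     (\<exists>c :: ('n \<Rightarrow> nat) \<Rightarrow> real.
        \<forall>x. p x = (\<Sum>\<alpha> | sum \<alpha> UNIV = m. c \<alpha> * (\<Prod>i\<in>UNIV. (x $ i) ^ \<alpha> i)))"

text \<open>The index set of the sum above is finite, so that the sum is not the default value \<open>0\<close>.\<close>

lemma finite_multi_indices: "finite {\<alpha> :: 'n::finite \<Rightarrow> nat. sum \<alpha> UNIV = m}"
proof (rule finite_subset)
  show "{\<alpha> :: 'n \<Rightarrow> nat. sum \<alpha> UNIV = m} \<subseteq> PiE UNIV (\<lambda>_. {..m})"
    by (auto simp: PiE_def intro: member_le_sum)
  show "finite (PiE (UNIV :: 'n set) (\<lambda>_. {..m}))"
    by (intro finite_PiE) auto
qed

definition homogeneous_harmonic_polynomial_mapping ::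
    "nat \<Rightarrow> (real^'n::finite \<Rightarrow> real^'k::finite) \<Rightarrow> bool" where
  "homogeneous_harmonic_polynomial_mapping m P \<longleftrightarrow>
     (\<forall>k. homogeneous_polynomial m (\<lambda>x. P x $ k) \<and> (\<forall>x. laplacian (\<lambda>y. P y $ k) x = 0))"

text \<open>The space \<open>L\<^sup>p\<close> over compact subsets of \<open>\<Omega>\<close>. For matrix-valued functions the norm is the
  Euclidean norm of the entries.\<close>

definition locally_Lp :: "nat \<Rightarrow> 'a::euclidean_space set \<Rightarrow> ('a \<Rightarrow> 'b::euclidean_space) \<Rightarrow> bool" where
  "locally_Lp p \<Omega> f \<longleftrightarrow> set_borel_measurable lebesgue \<Omega> f \<and>
     (\<forall>C. compact C \<and> C \<subseteq> \<Omega> \<longrightarrow> set_integrable lebesgue C (\<lambda>x. norm (f x) ^ p))"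

text \<open>The test functions are those of class \<open>C\<^sup>1\<close> with compact support in \<open>\<Omega>\<close>, as in the definition
  of weak derivatives by Gilbarg and Trudinger.\<close>

definition test_function :: "(real^'n::finite) set \<Rightarrow> (real^'n \<Rightarrow> real) \<Rightarrow> bool" where
  "test_function \<Omega> \<phi> \<longleftrightarrow>
     (\<forall>x. \<phi> differentiable at x) \<and> (\<forall>i. continuous_on UNIV (partial_derivative i \<phi>)) \<and>
     compact (closure {x. \<phi> x \<noteq> 0}) \<and> closure {x. \<phi> x \<noteq> 0} \<subseteq> \<Omega>"

text \<open>\<open>f\<close> is of class \<open>W(1,p)\<close> locally in \<open>\<Omega>\<close>, with weak differential \<open>D\<close>: the entry \<open>D x $ k $ j\<close> is
  the weak derivative of the \<open>k\<close>-th component of \<open>f\<close> in the \<open>j\<close>-th direction.\<close>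

definition has_W1p_loc_differential ::
    "nat \<Rightarrow> (real^'n::finite) set \<Rightarrow> (real^'n \<Rightarrow> real^'k::finite) \<Rightarrow> (real^'n \<Rightarrow> real^'n^'k) \<Rightarrow> bool" where
  "has_W1p_loc_differential p \<Omega> f D \<longleftrightarrow> locally_Lp p \<Omega> f \<and> locally_Lp p \<Omega> D \<and>
     (\<forall>\<phi> k j. test_function \<Omega> \<phi> \<longrightarrow>
        (LINT x:\<Omega>|lebesgue. f x $ k * partial_derivative j \<phi> x) =
        - (LINT x:\<Omega>|lebesgue. D x $ k $ j * \<phi> x))"

text \<open>A weak differential is unique up to null sets, so the existential quantifier over \<open>D\<close>
  only gives a name to it.\<close>

definition sense_preserving_quasiregular ::
    "real \<Rightarrow> (real^'n::finite) set \<Rightarrow> (real^'n \<Rightarrow> real^'n) \<Rightarrow> bool" where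
  "sense_preserving_quasiregular K \<Omega> f \<longleftrightarrow>
     open \<Omega> \<and> connected \<Omega> \<and> \<not> f constant_on \<Omega> \<and>
     (\<exists>D. has_W1p_loc_differential CARD('n) \<Omega> f D \<and>
        (AE x\<in>\<Omega> in lebesgue. 0 \<le> det (D x)) \<and>
        (AE x\<in>\<Omega> in lebesgue. onorm ((*v) (D x)) ^ CARD('n) \<le> K * det (D x)))"

text \<open>Reflection in the hyperplane through the origin orthogonal to \<open>v \<noteq> 0\<close>.\<close>

definition reflection :: "'a::real_inner \<Rightarrow> 'a \<Rightarrow> 'a" where
  "reflection v y = y - (2 * (y \<bullet> v) / (v \<bullet> v)) *\<^sub>R v"

definition quasiregular :: "(real^'n::finite) set \<Rightarrow> (real^'n \<Rightarrow> real^'n) \<Rightarrow> bool" where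
  "quasiregular \<Omega> f \<longleftrightarrow>
     (\<exists>K. sense_preserving_quasiregular K \<Omega> f) \<or>
     (\<exists>v. v \<noteq> 0 \<and> (\<exists>K. sense_preserving_quasiregular K \<Omega> (reflection v \<circ> f)))"

end

theory Submission
  imports Defs "HOL-Real_Asymp.Real_Asymp"
begin

text \<open>Let \<open>J = det DP\<close> be positive on the sphere. On the set \<open>J > 0\<close>, harmonicity gives
  \<open>\<Delta> log J = - \<Sum>\<^sub>i tr ((DP\<^sup>-\<^sup>1 \<partial>\<^sub>i DP)\<^sup>2)\<close>, and at a point of the sphere Euler's relation turns the right
  hand side into \<open>-(m - 1)\<^sup>2\<close> minus a sum of two squares. This is negative. But \<open>J\<close> is homogeneous of
  degree \<open>3 (m - 1)\<close>, so that \<open>\<Delta> log J \<ge> 3 (m - 1)\<close> at a minimum point of \<open>J\<close> on the sphere. After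
  linear changes of variables in source and target this point is the third basis vector and
  \<open>DP\<close> is the identity there; only the second derivatives of \<open>J\<close> in the two tangential directions
  are then needed.

  If \<open>P\<close> is quasiregular, its weak differential is the classical one and the distortion inequality
  holds everywhere. Together with Euler's relation \<open>DP(x) x = m P(x)\<close> it gives
  \<open>\<bar>DP(x)\<bar> \<le> C \<bar>P(x)\<bar> / \<bar>x\<bar>\<close>. If \<open>J\<close> vanished at a point of the sphere, so would \<open>P\<close>, and Gronwall's
  argument along segments would force \<open>P = 0\<close>.\<close>

section \<open>Partial derivatives of polynomials\<close>

lemma partial_derivative_eq:
  "(f has_derivative D) (at x) \<Longrightarrow> partial_derivative i f x = D (axis i 1)"
  by (simp add: partial_derivative_def frechet_derivative_at [symmetric])

lemma has_derivative_partial_derivatives: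
  fixes f :: "real^'n::finite \<Rightarrow> real"
  assumes "f differentiable at x"
  shows "(f has_derivative (\<lambda>v. \<Sum>i\<in>UNIV. v $ i * partial_derivative i f x)) (at x)"
proof -
  let ?D = "frechet_derivative f (at x)"
  have D: "(f has_derivative ?D) (at x)"
    using assms by (simp add: frechet_derivative_works)
  then interpret D: bounded_linear ?D by (rule has_derivative_bounded_linear)
  have "?D v = (\<Sum>i\<in>UNIV. v $ i * partial_derivative i f x)" for v
  proof -
    have "?D v = ?D (\<Sum>i\<in>UNIV. v $ i *s axis i 1)"
      by (simp add: basis_expansion)
    also have "\<dots> = (\<Sum>i\<in>UNIV. v $ i * partial_derivative i f x)"
      by (simp add: D.sum scalar_mult_eq_scaleR D.scaleR partial_derivative_def)
    finally show ?thesis .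
  qed
  then show ?thesis using D by presburger
qed

lemma continuous_real_polynomial_function:
  "real_polynomial_function p \<Longrightarrow> continuous_on A p"
  by (simp add: continuous_on_polymonial_function real_polynomial_function_eq)

context
  fixes f g :: "real^'n::finite \<Rightarrow> real"
  assumes f: "\<And>x. f differentiable at x" and g: "\<And>x. g differentiable at x"
begin

lemma partial_derivative_add:
  "partial_derivative i (\<lambda>x. f x + g x) = (\<lambda>x. partial_derivative i f x + partial_derivative i g x)"
  unfolding partial_derivative_def using f g
  by (intro ext) (subst frechet_derivative_at[symmetric], rule has_derivative_add, auto simp: frechet_derivative_works)

lemma partial_derivative_mult:
  "partial_derivative i (\<lambda>x. f x * g x) =
     (\<lambda>x. f x * partial_derivative i g x + partial_derivative i f x * g x)"
  unfolding partial_derivative_def using f g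
  by (intro ext) (subst frechet_derivative_at[symmetric], rule has_derivative_mult, auto simp: frechet_derivative_works)

end

lemma partial_derivative_const: "partial_derivative i (\<lambda>x. c) = (\<lambda>x. 0)"
  by (intro ext) (subst partial_derivative_eq[OF has_derivative_const], simp)

lemma partial_derivative_bounded_linear:
  "bounded_linear f \<Longrightarrow> partial_derivative i f = (\<lambda>x. f (axis i 1))"
  by (intro ext) (subst partial_derivative_eq[OF bounded_linear_imp_has_derivative], auto)

lemma partial_derivative_cmult:
  assumes "\<And>x. f differentiable at x"
  shows "partial_derivative i (\<lambda>x. c * f x) = (\<lambda>x. c * partial_derivative i f x)"
  by (subst partial_derivative_mult) (use assms in \<open>auto simp: partial_derivative_const\<close>)

lemma partial_derivative_sum:
  assumes "finite A" "\<And>a x. a \<in> A \<Longrightarrow> f a differentiable at x"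
  shows "partial_derivative i (\<lambda>x. \<Sum>a\<in>A. f a x) = (\<lambda>x. \<Sum>a\<in>A. partial_derivative i (f a) x)"
  using assms
proof (induction A rule: finite_induct)
  case (insert a A)
  have "partial_derivative i (\<lambda>x. f a x + (\<Sum>a\<in>A. f a x)) =
      (\<lambda>x. partial_derivative i (f a) x + partial_derivative i (\<lambda>x. \<Sum>a\<in>A. f a x) x)"
    using insert by (intro partial_derivative_add) (auto intro!: differentiable_sum)
  then show ?case using insert by simp
qed (simp add: partial_derivative_const)

lemma real_polynomial_function_partial_derivative:
  fixes p :: "real^'n::finite \<Rightarrow> real"
  shows "real_polynomial_function p \<Longrightarrow> real_polynomial_function (partial_derivative i p)"
proof (induction p rule: real_polynomial_function.induct)
  case (linear f)
  then show ?case by (auto simp: partial_derivative_bounded_linear)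
next
  case (const c)
  then show ?case by (auto simp: partial_derivative_const)
next
  case (add f g)
  then show ?case
    by (subst partial_derivative_add) (auto simp: differentiable_at_real_polynomial_function)
next
  case (mult f g)
  then show ?case
    by (subst partial_derivative_mult) (auto simp: differentiable_at_real_polynomial_function)
qed

text \<open>Polynomials are generated from linear functions and constants by sums and products, so
  symmetry follows by structural induction. For a product, the mixed Leibniz terms trade places when
  \<open>i\<close> and \<open>j\<close> are exchanged.\<close>

lemma partial_derivative_commute:
  fixes p :: "real^'n::finite \<Rightarrow> real"
  shows "real_polynomial_function p \<Longrightarrow>
    partial_derivative i (partial_derivative j p) = partial_derivative j (partial_derivative i p)"
proof (induction p rule: real_polynomial_function.induct)
  case (linear f)
  then show ?case by (simp add: partial_derivative_bounded_linear partial_derivative_const)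
next
  case (const c)
  then show ?case by (simp add: partial_derivative_const)
next
  case (add f g)
  then show ?case
    by (simp add: partial_derivative_add differentiable_at_real_polynomial_function
        real_polynomial_function_partial_derivative)
next
  case (mult f g)
  have d: "f differentiable at x" "g differentiable at x"
      "partial_derivative k f differentiable at x" "partial_derivative k g differentiable at x" for k x
    using mult(1,2)
    by (auto intro!: differentiable_at_real_polynomial_function real_polynomial_function_partial_derivative)
  have "partial_derivative i (partial_derivative j (\<lambda>x. f x * g x)) =
    (\<lambda>x. f x * partial_derivative i (partial_derivative j g) x + partial_derivative i f x * partial_derivative j g x +
      (partial_derivative j f x * partial_derivative i g x + partial_derivative i (partial_derivative j f) x * g x))"
    for i j
    by (simp add: partial_derivative_mult partial_derivative_add d)
  then show ?case
    using mult(3,4) by (simp add: algebra_simps)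
qed

lemma partial_derivative_comp_matrix:
  fixes f :: "real^'n::finite \<Rightarrow> real" and R :: "real^'m::finite^'n"
  assumes "\<And>x. f differentiable at x"
  shows "partial_derivative i (\<lambda>y. f (R *v y)) =
    (\<lambda>y. \<Sum>j\<in>UNIV. R $ j $ i * partial_derivative j f (R *v y))"
proof
  fix y
  have "((\<lambda>y. f (R *v y)) has_derivative
      (\<lambda>v. \<Sum>j\<in>UNIV. (R *v v) $ j * partial_derivative j f (R *v y))) (at y)"
    by (intro has_derivative_compose[OF _ has_derivative_partial_derivatives[OF assms]]
        bounded_linear_imp_has_derivative matrix_vector_mul_bounded_linear)
  from partial_derivative_eq[OF this, of i]
  show "partial_derivative i (\<lambda>y. f (R *v y)) y =
      (\<Sum>j\<in>UNIV. R $ j $ i * partial_derivative j f (R *v y))"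
    by (simp add: matrix_vector_mul_component matrix_vector_mult_basis column_def)
qed

lemma real_polynomial_function_comp_matrix:
  fixes R :: "real^'m::finite^'n::finite"
  assumes "real_polynomial_function p"
  shows "real_polynomial_function (\<lambda>y. p (R *v y))"
  using assms
  by (induction p rule: real_polynomial_function.induct)
     (auto intro: bounded_linear_compose matrix_vector_mul_bounded_linear)

section \<open>Derivatives along lines and Euler's relation\<close>

lemma has_real_derivative_along_line:
  fixes f :: "real^'n::finite \<Rightarrow> real"
  assumes "f differentiable at (x + t *\<^sub>R v)"
  shows "((\<lambda>t. f (x + t *\<^sub>R v)) has_real_derivative
    (\<Sum>i\<in>UNIV. v $ i * partial_derivative i f (x + t *\<^sub>R v))) (at t)"
proof -
  have "((\<lambda>t. x + t *\<^sub>R v) has_derivative (\<lambda>s. s *\<^sub>R v)) (at t)"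
    by (auto intro!: derivative_eq_intros)
  from has_derivative_compose[OF this has_derivative_partial_derivatives[OF assms]]
  have "((\<lambda>t. f (x + t *\<^sub>R v)) has_derivative
    (\<lambda>s. \<Sum>i\<in>UNIV. (s *\<^sub>R v) $ i * partial_derivative i f (x + t *\<^sub>R v))) (at t)" .
  then show ?thesis
    by (rule has_derivative_imp_has_field_derivative) (simp add: sum_distrib_left mult_ac)
qed

text \<open>Differentiate t -> p (t x) at t = 1, once by the chain rule and once by homogeneity.
  Homogeneity for t > 0 is also what \<open>homogeneous_partial_derivative\<close> delivers, so the
  relation applies to the derivatives of \<open>p\<close> in turn.\<close>

lemma euler_relation:
  fixes p :: "real^'n::finite \<Rightarrow> real"
  assumes "\<And>x. p differentiable at x" and h: "\<And>t x. t > 0 \<Longrightarrow> p (t *\<^sub>R x) = t ^ m * p x"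
  shows "(\<Sum>i\<in>UNIV. x $ i * partial_derivative i p x) = m * p x"
proof -
  have "((\<lambda>t. p (0 + t *\<^sub>R x)) has_real_derivative
    (\<Sum>i\<in>UNIV. x $ i * partial_derivative i p (0 + 1 *\<^sub>R x))) (at 1)"
    by (rule has_real_derivative_along_line) (rule assms)
  moreover have "((\<lambda>t. p (0 + t *\<^sub>R x)) has_real_derivative m * p x) (at 1)"
    by (rule has_field_derivative_transform_within_open[of "\<lambda>t. t ^ m * p x" _ _ "{0<..}"])
       (auto simp: h intro!: derivative_eq_intros)
  ultimately show ?thesis using DERIV_unique by force
qed

text \<open>Differentiate both sides of p (t x) = t^(m+1) p x in x and cancel one factor t.\<close>

lemma homogeneous_partial_derivative:
  fixes p :: "real^'n::finite \<Rightarrow> real"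
  assumes d: "\<And>x. p differentiable at x"
    and h: "\<And>t x. t > 0 \<Longrightarrow> p (t *\<^sub>R x) = t ^ Suc m * p x" and "t > 0"
  shows "partial_derivative i p (t *\<^sub>R x) = t ^ m * partial_derivative i p x"
proof -
  have "((\<lambda>x. p (t *\<^sub>R x)) has_derivative
     (\<lambda>v. \<Sum>i\<in>UNIV. (t *\<^sub>R v) $ i * partial_derivative i p (t *\<^sub>R x))) (at x)"
    by (intro has_derivative_compose[OF _ has_derivative_partial_derivatives[OF d]])
       (auto intro!: derivative_eq_intros)
  from partial_derivative_eq[OF this, of i]
  have "partial_derivative i (\<lambda>x. p (t *\<^sub>R x)) x = t * partial_derivative i p (t *\<^sub>R x)"
    by (simp add: axis_def if_distrib[of "\<lambda>u. u * _"] if_distrib[of "\<lambda>u. _ * u"] cong: if_cong)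
  moreover have "partial_derivative i (\<lambda>x. p (t *\<^sub>R x)) x = t ^ Suc m * partial_derivative i p x"
    using d by (simp only: h[OF \<open>t > 0\<close>] partial_derivative_cmult)
  ultimately show ?thesis using \<open>t > 0\<close> by simp
qed

section \<open>The Jacobian at a minimum on the sphere\<close>

text \<open>The function det (A t) - 1 - t^2 has a minimum at 0, so its first derivative vanishes
  there and its second is nonnegative. At the identity the derivatives of det along \<open>A\<close>
  are tr A' and tr A'' + (tr A')^2 - tr (A'^2); the bound 2 is the second derivative of t^2.\<close>

lemma det_second_derivative_ge:
  fixes A :: "real \<Rightarrow> real^3^3"
  assumes A': "\<And>k j t. ((\<lambda>t. A t $ k $ j) has_real_derivative A' t $ k $ j) (at t)"
    and A'': "\<And>k j. ((\<lambda>t. A' t $ k $ j) has_real_derivative A'' $ k $ j) (at 0)"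
    and A0: "A 0 = mat 1" and ge: "\<And>t. det (A t) \<ge> 1 + t\<^sup>2"
  shows "trace (A' 0) = 0" and "trace A'' - trace (A' 0 ** A' 0) \<ge> 2"
proof -
  define h where "h t = det (A t) - 1 - t\<^sup>2" for t
  define h' where "h' t =
    (let a = (\<lambda>k j. A t $ k $ j); b = (\<lambda>k j. A' t $ k $ j) in
    (b 1 1 * a 2 2 * a 3 3 + a 1 1 * b 2 2 * a 3 3 + a 1 1 * a 2 2 * b 3 3) +
    (b 1 2 * a 2 3 * a 3 1 + a 1 2 * b 2 3 * a 3 1 + a 1 2 * a 2 3 * b 3 1) +
    (b 1 3 * a 2 1 * a 3 2 + a 1 3 * b 2 1 * a 3 2 + a 1 3 * a 2 1 * b 3 2) -
    (b 1 1 * a 2 3 * a 3 2 + a 1 1 * b 2 3 * a 3 2 + a 1 1 * a 2 3 * b 3 2) -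
    (b 1 2 * a 2 1 * a 3 3 + a 1 2 * b 2 1 * a 3 3 + a 1 2 * a 2 1 * b 3 3) -
    (b 1 3 * a 2 2 * a 3 1 + a 1 3 * b 2 2 * a 3 1 + a 1 3 * a 2 2 * b 3 1) - 2 * t)" for t
  have a0 [simp]: "A 0 $ k $ j = (if k = j then 1 else 0)" for k j
    by (simp add: A0 mat_def)
  have h: "(h has_real_derivative h' t) (at t)" for t
    unfolding h_def h'_def Let_def det_3
    by (rule derivative_eq_intros A' refl | simp)+ (simp add: algebra_simps)
  have h0: "h 0 = 0" by (simp add: h_def A0)
  have h_nonneg: "h t \<ge> 0" for t using ge[of t] by (simp add: h_def)
  have "h' 0 = 0"
    by (rule DERIV_local_min[OF h, of 1]) (use h0 h_nonneg in auto)
  then show tr: "trace (A' 0) = 0"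
    by (simp add: h'_def Let_def trace_def sum_3)
  define d where "d = trace A'' + (trace (A' 0))\<^sup>2 - trace (A' 0 ** A' 0) - 2"
  have h': "(h' has_real_derivative d) (at 0)"
    unfolding h'_def Let_def
    apply (rule derivative_eq_intros A' A'' refl | simp)+
    apply (simp add: d_def trace_def sum_3 matrix_matrix_mult_def power2_eq_square algebra_simps)
    done
  \<comment> \<open>\<open>d\<close> is the second derivative of \<open>h\<close> at 0. Were it
    negative, \<open>h'\<close> would be negative just to the right of 0, and the mean value theorem
    would give a negative value of \<open>h\<close>.\<close>
  have "d \<ge> 0"
  proof (rule ccontr)
    assume "\<not> d \<ge> 0"
    then have "d < 0" by simp
    from DERIV_neg_dec_right[OF h' this] \<open>h' 0 = 0\<close>
    obtain \<delta> where \<delta>: "\<delta> > 0" "\<And>t. 0 < t \<Longrightarrow> t < \<delta> \<Longrightarrow> h' t < 0" by auto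
    obtain z where "0 < z" "z < \<delta> / 2" "h (\<delta> / 2) - h 0 = (\<delta> / 2 - 0) * h' z"
      using MVT2[of 0 "\<delta> / 2" h h'] h \<delta> by auto
    then show False
      using \<delta>(1) \<delta>(2)[of z] h_nonneg[of "\<delta> / 2"] h0
      by (smt (verit) mult_pos_neg field_sum_of_halves)
  qed
  then show "trace A'' - trace (A' 0 ** A' 0) \<ge> 2"
    using tr by (simp add: d_def)
qed

text \<open>A coefficient-free form of the condition on one component, convenient for linear
  substitutions and linear combinations. Scaling holds for all real t, including negative ones;
  segments through the origin use this later.\<close>

definition homogeneous_harmonic :: "nat \<Rightarrow> (real^'n::finite \<Rightarrow> real) \<Rightarrow> bool" where
  "homogeneous_harmonic m p \<longleftrightarrow> real_polynomial_function p \<and>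
     (\<forall>t x. p (t *\<^sub>R x) = t ^ m * p x) \<and> (\<forall>x. laplacian p x = 0)"

lemma homogeneous_polynomial_imp:
  fixes p :: "real^'n::finite \<Rightarrow> real"
  assumes "homogeneous_polynomial m p"
  shows "real_polynomial_function p" and "p (t *\<^sub>R x) = t ^ m * p x"
proof -
  obtain c where c: "p = (\<lambda>x. \<Sum>\<alpha> | sum \<alpha> UNIV = m. c \<alpha> * (\<Prod>i\<in>UNIV. (x $ i) ^ \<alpha> i))"
    using assms unfolding homogeneous_polynomial_def by auto
  show "real_polynomial_function p"
    unfolding c
    by (intro real_polynomial_function_sum finite_multi_indices real_polynomial_function.intros(4)
        real_polynomial_function.intros(2) real_polynomial_function_prod finite
        real_polynomial_function_power real_polynomial_function.intros(1) bounded_linear_vec_nth)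
  have "(\<Prod>i\<in>UNIV. ((t *\<^sub>R x) $ i) ^ \<alpha> i) = t ^ sum \<alpha> UNIV * (\<Prod>i\<in>UNIV. (x $ i) ^ \<alpha> i)" for \<alpha>
    by (simp add: power_mult_distrib prod.distrib power_sum)
  then show "p (t *\<^sub>R x) = t ^ m * p x"
    unfolding c sum_distrib_left by (intro sum.cong) auto
qed

lemma homogeneous_harmonic_component:
  "homogeneous_harmonic_polynomial_mapping m P \<Longrightarrow> homogeneous_harmonic m (\<lambda>x. P x $ k)"
  using homogeneous_polynomial_imp[of m "\<lambda>x. P x $ k"]
  by (auto simp: homogeneous_harmonic_polynomial_mapping_def homogeneous_harmonic_def)

lemma homogeneous_harmonic_differentiable:
  "homogeneous_harmonic m p \<Longrightarrow> p differentiable at x"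
  by (simp add: homogeneous_harmonic_def differentiable_at_real_polynomial_function)

text \<open>The chain rule turns the Hessian H into R^T H R, whose trace is the sum of the products
  (R R^T)_jl H_jl, and R R^T is the identity.\<close>

lemma homogeneous_harmonic_comp_orthogonal:
  fixes R :: "real^'n::finite^'n"
  assumes p: "homogeneous_harmonic m p" and R: "orthogonal_matrix R"
  shows "homogeneous_harmonic m (\<lambda>y. p (R *v y))"
proof -
  have poly: "real_polynomial_function p" using p by (simp add: homogeneous_harmonic_def)
  have d: "p differentiable at x" "partial_derivative j p differentiable at x"
    "(\<lambda>y. partial_derivative j p (R *v y)) differentiable at x" for j x
    using poly by (auto intro!: differentiable_at_real_polynomial_function
        real_polynomial_function_partial_derivative real_polynomial_function_comp_matrix)
  have "R ** transpose R = mat 1"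
    using R by (simp add: orthogonal_matrix_def)
  then have RR: "(\<Sum>i\<in>UNIV. R $ j $ i * R $ l $ i) = (if j = l then 1 else 0)" for j l
    by (simp add: matrix_matrix_mult_def transpose_def mat_def vec_eq_iff)
  have "laplacian (\<lambda>y. p (R *v y)) y = 0" for y
  proof -
    have "laplacian (\<lambda>y. p (R *v y)) y =
      (\<Sum>i\<in>UNIV. \<Sum>j\<in>UNIV. R $ j $ i * (\<Sum>l\<in>UNIV. R $ l $ i *
        partial_derivative l (partial_derivative j p) (R *v y)))"
      unfolding laplacian_def
      by (simp add: partial_derivative_comp_matrix d partial_derivative_sum partial_derivative_cmult)
    also have "\<dots> = (\<Sum>i\<in>UNIV. \<Sum>j\<in>UNIV. \<Sum>l\<in>UNIV. R $ j $ i * R $ l $ i *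
        partial_derivative l (partial_derivative j p) (R *v y))"
      by (simp add: sum_distrib_left mult.assoc)
    also have "\<dots> = (\<Sum>j\<in>UNIV. \<Sum>i\<in>UNIV. \<Sum>l\<in>UNIV. R $ j $ i * R $ l $ i *
        partial_derivative l (partial_derivative j p) (R *v y))"
      by (rule sum.swap)
    also have "\<dots> = (\<Sum>j\<in>UNIV. \<Sum>l\<in>UNIV. \<Sum>i\<in>UNIV. R $ j $ i * R $ l $ i *
        partial_derivative l (partial_derivative j p) (R *v y))"
      by (rule sum.cong[OF refl], rule sum.swap)
    also have "\<dots> = (\<Sum>j\<in>UNIV. \<Sum>l\<in>UNIV. (if j = l then 1 else 0) *
        partial_derivative l (partial_derivative j p) (R *v y))"
      by (simp only: RR flip: sum_distrib_right)
    also have "\<dots> = laplacian p (R *v y)"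
      by (simp add: laplacian_def if_distrib[of "\<lambda>u. u * _"] cong: if_cong)
    finally show ?thesis using p by (simp add: homogeneous_harmonic_def)
  qed
  then show ?thesis
    using p by (auto simp: homogeneous_harmonic_def matrix_vector_mult_scaleR
        intro: real_polynomial_function_comp_matrix)
qed

lemma homogeneous_harmonic_sum:
  fixes p :: "'a \<Rightarrow> real^'n::finite \<Rightarrow> real"
  assumes p: "\<And>a. a \<in> A \<Longrightarrow> homogeneous_harmonic m (p a)" and A: "finite A"
  shows "homogeneous_harmonic m (\<lambda>x. \<Sum>a\<in>A. c a * p a x)"
proof -
  have poly: "real_polynomial_function (p a)" if "a \<in> A" for a
    using p that by (simp add: homogeneous_harmonic_def)
  have d: "p a differentiable at x" "partial_derivative i (p a) differentiable at x" if "a \<in> A" for a i x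
    using poly[OF that] by (auto intro!: differentiable_at_real_polynomial_function
        real_polynomial_function_partial_derivative)
  have pd: "partial_derivative i (\<lambda>x. \<Sum>a\<in>A. c a * p a x) = (\<lambda>x. \<Sum>a\<in>A. c a * partial_derivative i (p a) x)" for i
    using A d by (subst partial_derivative_sum) (auto intro!: sum.cong simp: partial_derivative_cmult)
  have pd2: "partial_derivative i (\<lambda>x. \<Sum>a\<in>A. c a * partial_derivative i (p a) x) =
      (\<lambda>x. \<Sum>a\<in>A. c a * partial_derivative i (partial_derivative i (p a)) x)" for i
    using A d by (subst partial_derivative_sum) (auto intro!: sum.cong simp: partial_derivative_cmult)
  have "laplacian (\<lambda>x. \<Sum>a\<in>A. c a * p a x) x = (\<Sum>a\<in>A. c a * laplacian (p a) x)" for x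
    unfolding laplacian_def pd pd2 sum_distrib_left by (rule sum.swap)
  moreover have "real_polynomial_function (\<lambda>x. \<Sum>a\<in>A. c a * p a x)"
    using A poly by (intro real_polynomial_function_sum) auto
  ultimately show ?thesis
    using p by (auto simp: homogeneous_harmonic_def sum_distrib_left mult_ac intro!: sum.cong)
qed

text \<open>The change of variables in the target: harmonicity and homogeneity are linear
  conditions, so any matrix is admissible here, while orthogonal ones are taken in the
  source.\<close>

lemma homogeneous_harmonic_matrix_vector_mult:
  fixes P :: "real^'n::finite \<Rightarrow> real^'k::finite" and B :: "real^'k^'l::finite"
  assumes "\<And>k. homogeneous_harmonic m (\<lambda>x. P x $ k)"
  shows "homogeneous_harmonic m (\<lambda>x. (B *v P x) $ l)"
  unfolding matrix_vector_mult_def using assms by (simp add: homogeneous_harmonic_sum)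

section \<open>Jacobian matrices and their determinants\<close>

lemma has_derivative_jacobian:
  fixes P :: "real^'n::finite \<Rightarrow> real^'k::finite"
  assumes "\<And>k. (\<lambda>x. P x $ k) differentiable at x"
  shows "(P has_derivative (*v) (jacobian P (at x))) (at x)"
proof -
  have "P differentiable at x"
    using assms by (subst differentiable_componentwise_within) (auto simp: Basis_vec_def inner_axis)
  then show ?thesis by (simp add: jacobian_works)
qed

lemma jacobian_nth:
  fixes P :: "real^'n::finite \<Rightarrow> real^'k::finite"
  assumes "\<And>k. (\<lambda>x. P x $ k) differentiable at x"
  shows "jacobian P (at x) $ k $ j = partial_derivative j (\<lambda>x. P x $ k) x"
proof -
  have "((\<lambda>x. P x $ k) has_derivative (\<lambda>v. (jacobian P (at x) *v v) $ k)) (at x)"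
    by (intro bounded_linear.has_derivative[OF bounded_linear_vec_nth] has_derivative_jacobian assms)
  from partial_derivative_eq[OF this, of j] show ?thesis
    by (simp add: matrix_vector_mult_basis column_def)
qed

lemma jacobian_eq:
  fixes P :: "real^'n::finite \<Rightarrow> real^'k::finite"
  assumes "(P has_derivative (*v) A) (at x)"
  shows "jacobian P (at x) = A"
  by (simp add: jacobian_def frechet_derivative_at[OF assms, symmetric])

lemma jacobian_matrix_comp:
  fixes P :: "real^'n::finite \<Rightarrow> real^'k::finite"
  assumes "\<And>k x. (\<lambda>x. P x $ k) differentiable at x"
  shows "jacobian (\<lambda>y. B *v P (R *v y)) (at y) = B ** (jacobian P (at (R *v y)) ** R)"
proof (rule jacobian_eq)
  have "((\<lambda>y. R *v y) has_derivative (\<lambda>v. R *v v)) (at y)"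
    by (intro bounded_linear_imp_has_derivative matrix_vector_mul_bounded_linear)
  from has_derivative_compose[OF this has_derivative_jacobian[OF assms]]
  have "((\<lambda>y. B *v P (R *v y)) has_derivative (\<lambda>v. B *v (jacobian P (at (R *v y)) *v (R *v v)))) (at y)"
    by (rule bounded_linear.has_derivative[OF matrix_vector_mul_bounded_linear])
  then show "((\<lambda>y. B *v P (R *v y)) has_derivative (*v) (B ** (jacobian P (at (R *v y)) ** R))) (at y)"
    by (simp only: matrix_vector_mul_assoc)
qed

text \<open>The entries of the Jacobian matrix have degree \<open>n\<close>, one less than the
  components, so each row releases a factor t^n.\<close>

lemma det_jacobian_homogeneous:
  fixes P :: "real^'n::finite \<Rightarrow> real^'n"
  assumes P: "\<And>k. homogeneous_harmonic (Suc n) (\<lambda>x. P x $ k)" and "t > 0"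
  shows "det (jacobian P (at (t *\<^sub>R x))) = (t ^ n) ^ CARD('n) * det (jacobian P (at x))"
proof -
  have "jacobian P (at (t *\<^sub>R x)) = t ^ n *\<^sub>R jacobian P (at x)"
    using homogeneous_partial_derivative[OF homogeneous_harmonic_differentiable[OF P] _ \<open>t > 0\<close>, of _ n]
      P by (simp add: vec_eq_iff jacobian_nth[OF homogeneous_harmonic_differentiable[OF P]]
        homogeneous_harmonic_def)
  also have "\<dots> = (\<chi> i. t ^ n *s jacobian P (at x) $ i)"
    by (simp add: vec_eq_iff)
  finally show ?thesis by (simp add: det_rows_mul)
qed

text \<open>The degree is n + 2. At the minimum point, Euler's relation fixes the second derivatives
  involving direction 3, and harmonicity leaves six free ones. The second-order conditions in the
  two tangential directions add up to 4 <= 9/4 - (n - 1/2)^2 minus two squares, which is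
  absurd.\<close>

lemma no_normalized_minimum:
  fixes Q :: "real^3 \<Rightarrow> real^3"
  assumes Q: "\<And>k. homogeneous_harmonic (Suc (Suc n)) (\<lambda>x. Q x $ k)"
    and id: "jacobian Q (at (axis 3 1)) = mat 1"
    and ge: "\<And>y. norm y = 1 \<Longrightarrow> det (jacobian Q (at y)) \<ge> 1"
  shows False
proof -
  define e :: "real^3" where "e = axis 3 1"
  define b where "b k j = partial_derivative j (\<lambda>x. Q x $ k)" for k j
  define c where "c k i j = partial_derivative i (b k j)" for k i j
  define d where "d k l i j = partial_derivative l (c k i j)" for k l i j
  have polyQ: "real_polynomial_function (\<lambda>x. Q x $ k)" for k
    using Q by (simp add: homogeneous_harmonic_def)
  then have polyb: "real_polynomial_function (b k j)" for k j
    unfolding b_def by (rule real_polynomial_function_partial_derivative)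
  then have polyc: "real_polynomial_function (c k i j)" for k i j
    unfolding c_def by (rule real_polynomial_function_partial_derivative)
  note diff = polyQ[THEN differentiable_at_real_polynomial_function, where S = UNIV]
    polyb[THEN differentiable_at_real_polynomial_function, where S = UNIV]
    polyc[THEN differentiable_at_real_polynomial_function, where S = UNIV]
  have c_sym: "c k i j = c k j i" for k i j
    unfolding c_def b_def by (rule partial_derivative_commute[OF polyQ])
  have jac: "jacobian Q (at x) $ k $ j = b k j x" for x k j
    by (simp add: b_def jacobian_nth diff)
  have hom1: "b k j (t *\<^sub>R x) = t ^ Suc n * b k j x" if "t > 0" for k j t x
    unfolding b_def using Q that
    by (intro homogeneous_partial_derivative) (auto simp: homogeneous_harmonic_def diff)
  have hom2: "c k i j (t *\<^sub>R x) = t ^ n * c k i j x" if "t > 0" for k i j t x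
    unfolding c_def using hom1 that
    by (intro homogeneous_partial_derivative) (auto simp: diff)
  have be: "b k j e = (if k = j then 1 else 0)" for k j
    using id by (simp add: jac[symmetric] e_def mat_def)
  \<comment> \<open>At \<open>e\<close> the radial direction is direction 3, so Euler's relation
    evaluates derivatives in that direction.\<close>
  have at_e: "(\<Sum>i\<in>UNIV. e $ i * f i) = f 3" for f :: "3 \<Rightarrow> real"
    by (simp add: e_def axis_def if_distrib[of "\<lambda>u. u * _"] cong: if_cong)
  have c3: "c k 3 j e = (if k = j then real n + 1 else 0)" for k j
    using euler_relation[of "b k j" "Suc n" e] hom1
    by (simp add: diff at_e be flip: c_def)
  have d33: "d k 3 3 j e = (if k = j then n * (real n + 1) else 0)" for k j
    using euler_relation[of "c k 3 j" n e] hom2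
    by (simp add: diff at_e c3 flip: d_def)
  have harm: "c k 1 1 x + c k 2 2 x + c k 3 3 x = 0" for k x
    using Q[of k] by (simp add: homogeneous_harmonic_def laplacian_def sum_3 b_def c_def)
  \<comment> \<open>Laplace's equation for component \<open>k\<close>, differentiated in direction
    \<open>j\<close>, with \<open>j\<close> moved outermost by symmetry.\<close>
  have harm': "d k 1 1 j e + d k 2 2 j e + d k 3 3 j e = 0" for k j
  proof -
    have "d k i i j = partial_derivative j (c k i i)" for i
      unfolding d_def c_sym[of k i j] unfolding c_def by (rule partial_derivative_commute[OF polyb])
    moreover have "partial_derivative j (\<lambda>x. c k 1 1 x + c k 2 2 x + c k 3 3 x) = (\<lambda>x. 0)"
      by (simp only: harm partial_derivative_const)
    ultimately show ?thesis
      by (simp add: partial_derivative_add diff fun_eq_iff)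
  qed
  \<comment> \<open>A point y of the tangent line has |y|^2 = 1 + t^2, and by homogeneity the
    determinant there is at least |y|^(3 (n + 1)). The weaker bound |y|^2 already leads to the
    contradiction for every \<open>n\<close>.\<close>
  have ge_axis: "det (jacobian Q (at (e + t *\<^sub>R axis i 1))) \<ge> 1 + t\<^sup>2" if "i \<noteq> 3" for i t
  proof -
    define y where "y = e + t *\<^sub>R (axis i 1 :: real^3)"
    have y2: "(norm y)\<^sup>2 = 1 + t\<^sup>2"
    proof -
      have ortho: "e \<bullet> e = 1" "e \<bullet> axis i 1 = 0" "axis i 1 \<bullet> e = 0" "(axis i 1 :: real^3) \<bullet> axis i 1 = 1"
        using that by (simp_all add: e_def inner_axis_axis)
      show ?thesis
        by (simp only: power2_norm_eq_inner y_def inner_add_left inner_add_right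
            inner_scaleR_left inner_scaleR_right ortho) (simp add: power2_eq_square)
    qed
    have "1\<^sup>2 \<le> (norm y)\<^sup>2" unfolding y2 by simp
    then have y1: "norm y \<ge> 1" by (rule power2_le_imp_le) (rule norm_ge_zero)
    have y_pos: "norm y > 0" using y1 by linarith
    have card_3: "CARD(3) = 3" by simp
    have "norm y ^ 2 \<le> norm y ^ (Suc n * 3)"
      using y1 by (intro power_increasing) auto
    also have "\<dots> = (norm y ^ Suc n) ^ 3 * 1" by (simp only: power_mult mult_1_right)
    also have "\<dots> \<le> (norm y ^ Suc n) ^ 3 * det (jacobian Q (at (y /\<^sub>R norm y)))"
      using y_pos by (intro mult_left_mono ge zero_le_power norm_ge_zero) simp
    also have "\<dots> = det (jacobian Q (at (norm y *\<^sub>R (y /\<^sub>R norm y))))"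
      using det_jacobian_homogeneous[OF Q y_pos, of "y /\<^sub>R norm y"] by (simp only: card_3)
    also have "norm y *\<^sub>R (y /\<^sub>R norm y) = y" using y_pos by simp
    finally show ?thesis by (simp only: y2) (simp only: y_def)
  qed
  have key: "c 1 i 1 e + c 2 i 2 e + c 3 i 3 e = 0 \<and>
     (d 1 i i 1 e + d 2 i i 2 e + d 3 i i 3 e) -
     (\<Sum>k\<in>UNIV. \<Sum>j\<in>UNIV. c k i j e * c j i k e) \<ge> 2" if "i \<noteq> 3" for i
  proof -
    define A where "A t = jacobian Q (at (e + t *\<^sub>R axis i 1))" for t
    define A' where "A' t = (\<chi> k j. c k i j (e + t *\<^sub>R axis i 1))" for t
    define A'' where "A'' = (\<chi> k j. d k i i j e)"
    have sel: "(\<Sum>l\<in>UNIV. (axis i 1 :: real^3) $ l * f l) = f i" for f :: "3 \<Rightarrow> real"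
      by (simp add: axis_def if_distrib[of "\<lambda>u. u * _"] cong: if_cong)
    have 1: "((\<lambda>t. A t $ k $ j) has_real_derivative A' t $ k $ j) (at t)" for k j t
      using has_real_derivative_along_line[OF diff(2)[of k j], where x = e and t = t and v = "axis i 1"]
      by (simp add: A_def jac A'_def sel flip: c_def)
    have 2: "((\<lambda>t. A' t $ k $ j) has_real_derivative A'' $ k $ j) (at 0)" for k j
      using has_real_derivative_along_line[OF diff(3)[of k i j], where x = e and t = 0 and v = "axis i 1"]
      by (simp add: A'_def A''_def sel flip: d_def)
    have 3: "A 0 = mat 1" by (simp add: A_def e_def id)
    have 4: "det (A t) \<ge> 1 + t\<^sup>2" for t
      unfolding A_def using that by (rule ge_axis)
    show ?thesis
      using det_second_derivative_ge[of A A' A'', OF 1 2 3 4]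
      by (simp add: A'_def A''_def trace_def matrix_matrix_mult_def sum_3)
  qed
  \<comment> \<open>The six free second derivatives; symmetry, \<open>c3\<close> and harmonicity
    express all the others through them.\<close>
  define p q r s t u where vars: "p = c 1 1 1 e" "q = c 2 1 1 e" "r = c 3 1 1 e"
    "s = c 1 1 2 e" "t = c 2 1 2 e" "u = c 3 1 2 e"
  have neq: "(1::3) \<noteq> 3" "(2::3) \<noteq> 3" by simp_all
  have c_12: "c k 2 1 e = c k 1 2 e" "c k 1 3 e = c k 3 1 e" "c k 2 3 e = c k 3 2 e"
    "c k 2 2 e = - c k 1 1 e - c k 3 3 e" for k
    using harm[of k e] by (simp_all add: c_sym)
  have vals: "c 1 2 1 e = s" "c 2 2 1 e = t" "c 3 2 1 e = u"
    "c 1 2 2 e = - p" "c 2 2 2 e = - q" "c 3 2 2 e = - r - (n + 1)"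
    "c 1 1 3 e = n + 1" "c 2 1 3 e = 0" "c 3 1 3 e = 0"
    "c 1 2 3 e = 0" "c 2 2 3 e = n + 1" "c 3 2 3 e = 0"
    using c_12 by (simp_all add: vars c3)
  \<comment> \<open>By \<open>harm'\<close> the tangential third derivatives sum to minus those
    taken twice in direction 3, which \<open>d33\<close> evaluates.\<close>
  have D: "(d 1 1 1 1 e + d 2 1 1 2 e + d 3 1 1 3 e) + (d 1 2 2 1 e + d 2 2 2 2 e + d 3 2 2 3 e)
     = - 3 * (n * (real n + 1))"
    using harm'[of 1 1] harm'[of 2 2] harm'[of 3 3] by (simp add: d33)
  have M1: "(\<Sum>k\<in>UNIV. \<Sum>j\<in>UNIV. c k 1 j e * c j 1 k e) =
      p\<^sup>2 + t\<^sup>2 + 2 * (s * q) + 2 * ((real n + 1) * r)"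
    by (simp only: sum_3 vals vars(1-6)[symmetric] power2_eq_square) (simp add: algebra_simps)
  have M2: "(\<Sum>k\<in>UNIV. \<Sum>j\<in>UNIV. c k 2 j e * c j 2 k e) =
      s\<^sup>2 + q\<^sup>2 - 2 * (p * t) - 2 * ((real n + 1) * r) - 2 * (real n + 1)\<^sup>2"
    by (simp only: sum_3 vals vars(1-6)[symmetric] power2_eq_square) (simp add: algebra_simps)
  have "(p - t)\<^sup>2 = p\<^sup>2 + t\<^sup>2 - 2 * (p * t)" "(s + q)\<^sup>2 = s\<^sup>2 + q\<^sup>2 + 2 * (s * q)"
    by (simp_all add: power2_diff power2_sum)
  \<comment> \<open>Adding \<open>M1\<close> and \<open>M2\<close> cancels the terms in
    \<open>r\<close> and completes two squares.\<close>
  then have "4 \<le> - 3 * (n * (real n + 1)) - ((p - t)\<^sup>2 + (s + q)\<^sup>2 - 2 * (real n + 1)\<^sup>2)"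
    using key[OF neq(1), THEN conjunct2, unfolded M1] key[OF neq(2), THEN conjunct2, unfolded M2] D by linarith
  moreover have "0 \<le> (p - t)\<^sup>2" "0 \<le> (s + q)\<^sup>2" by simp_all
  ultimately have "4 \<le> 2 * (real n + 1)\<^sup>2 - 3 * (n * (real n + 1))"
    by linarith
  \<comment> \<open>The right-hand side above equals 9/4 - (n - 1/2)^2, hence is below 4.\<close>
  moreover have "0 \<le> (real n - 1 / 2)\<^sup>2" by simp
  ultimately show False by (simp add: power2_eq_square algebra_simps)
qed

section \<open>Attainment and normalization of the minimum\<close>

lemma continuous_det_jacobian:
  fixes P :: "real^'n::finite \<Rightarrow> real^'n"
  assumes "\<And>k. real_polynomial_function (\<lambda>x. P x $ k)"
  shows "continuous_on S (\<lambda>x. det (jacobian P (at x)))"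
  unfolding det_def jacobian_nth[OF differentiable_at_real_polynomial_function[OF assms]]
  by (intro continuous_intros continuous_real_polynomial_function
      real_polynomial_function_partial_derivative assms)

text \<open>By compactness the Jacobian attains its minimum on the sphere at some \<open>x0\<close>.
  The rotation \<open>R\<close> takes the third basis vector to \<open>x0\<close>, and
  \<open>B\<close>, the inverse of DP(x0) R, makes the differential the identity there. As det B >
  0, minimality becomes the lower bound 1.\<close>

lemma no_positive_jacobian:
  fixes P :: "real^3 \<Rightarrow> real^3"
  assumes P: "\<And>k. homogeneous_harmonic m (\<lambda>x. P x $ k)" and "m > 1"
    and pos: "\<And>x. x \<in> sphere 0 1 \<Longrightarrow> det (jacobian P (at x)) > 0"
  shows False
proof -
  obtain n where m: "m = Suc (Suc n)"
    using \<open>m > 1\<close> by (metis less_imp_Suc_add add.commute plus_1_eq_Suc add_Suc_right)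
  have poly: "real_polynomial_function (\<lambda>x. P x $ k)" for k
    using P by (simp add: homogeneous_harmonic_def)
  have "(sphere 0 1 :: (real^3) set) \<noteq> {}" by simp
  then obtain x0 where x0: "x0 \<in> sphere 0 1"
    and min: "\<And>x. x \<in> sphere 0 1 \<Longrightarrow> det (jacobian P (at x0)) \<le> det (jacobian P (at x))"
    using continuous_attains_inf[OF compact_sphere _ continuous_det_jacobian[OF poly]] by blast
  then obtain R where R: "rotation_matrix R" "R *v axis 3 1 = x0"
    using rotation_matrix_exists_basis[of x0 3] by auto
  then have orth: "orthogonal_matrix R" and detR: "det R = 1"
    by (simp_all add: rotation_matrix_def)
  define A where "A = jacobian P (at x0) ** R"
  have detA: "det A = det (jacobian P (at x0))" by (simp add: A_def det_mul detR)
  have "invertible A"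
    using pos[OF x0] by (simp add: invertible_det_nz detA)
  then obtain B where BA: "B ** A = mat 1"
    by (auto simp: invertible_def)
  then have detB: "det B * det A = 1" by (metis det_I det_mul)
  define Q where "Q = (\<lambda>y. B *v P (R *v y))"
  have jacQ: "jacobian Q (at y) = B ** (jacobian P (at (R *v y)) ** R)" for y
    unfolding Q_def using P by (intro jacobian_matrix_comp homogeneous_harmonic_differentiable)
  show False
  proof (rule no_normalized_minimum[of n Q])
    show "homogeneous_harmonic (Suc (Suc n)) (\<lambda>x. Q x $ k)" for k
      unfolding Q_def m[symmetric]
      using homogeneous_harmonic_comp_orthogonal[OF homogeneous_harmonic_matrix_vector_mult[OF P] orth] .
    show "jacobian Q (at (axis 3 1)) = mat 1"
      using BA by (simp add: jacQ R A_def)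
    show "1 \<le> det (jacobian Q (at y))" if "norm y = 1" for y
    proof -
      have "R *v y \<in> sphere 0 1"
        using orth that by (simp add: orthogonal_transformation_matrix
            orthogonal_transformation_norm[of "(*v) R"])
      from min[OF this] have "det A \<le> det (jacobian P (at (R *v y)))" by (simp add: detA)
      moreover have "det B > 0"
        using detB pos[OF x0] detA by (metis zero_less_mult_pos2 zero_less_one)
      ultimately show ?thesis
        using detB by (simp add: jacQ det_mul detR) (metis mult_left_mono less_imp_le)
    qed
  qed
qed

section \<open>Zeros of the Jacobian under bounded distortion\<close>

text \<open>By Cauchy-Schwarz and the bound, exp (-2 C t) |\<gamma> t|^2 is nonincreasing, and it
  starts at 0.\<close>

lemma gronwall_zero:
  fixes \<gamma> :: "real \<Rightarrow> 'b::real_inner"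
  assumes \<gamma>: "\<And>t. t \<in> {0..1} \<Longrightarrow> (\<gamma> has_vector_derivative \<gamma>' t) (at t)"
    and bound: "\<And>t. t \<in> {0..1} \<Longrightarrow> norm (\<gamma>' t) \<le> C * norm (\<gamma> t)" and "\<gamma> 0 = 0"
  shows "\<gamma> 1 = 0"
proof -
  define g where "g t = exp (- 2 * C * t) * (\<gamma> t \<bullet> \<gamma> t)" for t
  have "g 1 \<le> g 0"
  proof (rule DERIV_nonpos_imp_nonincreasing[of 0 1 g])
    fix t :: real assume "0 \<le> t" "t \<le> 1"
    then have t: "t \<in> {0..1}" by simp
    have "((\<lambda>t. \<gamma> t \<bullet> \<gamma> t) has_derivative (\<lambda>h. \<gamma> t \<bullet> h *\<^sub>R \<gamma>' t + h *\<^sub>R \<gamma>' t \<bullet> \<gamma> t)) (at t)"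
      using \<gamma>[OF t] unfolding has_vector_derivative_def by (intro has_derivative_inner)
    then have "((\<lambda>t. \<gamma> t \<bullet> \<gamma> t) has_real_derivative 2 * (\<gamma> t \<bullet> \<gamma>' t)) (at t)"
      by (rule has_derivative_imp_has_field_derivative) (simp add: inner_commute)
    then have "(g has_real_derivative exp (- 2 * C * t) * (2 * (\<gamma> t \<bullet> \<gamma>' t) - 2 * C * (\<gamma> t \<bullet> \<gamma> t))) (at t)"
      unfolding g_def by (auto intro!: derivative_eq_intros simp: algebra_simps)
    moreover have "\<gamma> t \<bullet> \<gamma>' t \<le> norm (\<gamma> t) * (C * norm (\<gamma> t))"
      by (rule order_trans[OF norm_cauchy_schwarz mult_left_mono[OF bound[OF t]]]) simp
    then have "2 * (\<gamma> t \<bullet> \<gamma>' t) - 2 * C * (\<gamma> t \<bullet> \<gamma> t) \<le> 0"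
      by (simp add: dot_square_norm power2_eq_square mult_ac)
    ultimately show "\<exists>y. (g has_real_derivative y) (at t) \<and> y \<le> 0"
      by (auto intro!: exI mult_nonneg_nonpos)
  qed simp
  then have "\<gamma> 1 \<bullet> \<gamma> 1 \<le> 0"
    using \<open>\<gamma> 0 = 0\<close> by (simp add: g_def mult_le_0_iff)
  then show ?thesis by (metis inner_eq_zero_iff inner_ge_zero order_antisym)
qed

text \<open>A crude Hadamard inequality: each of the six products in the expansion takes one entry
  from each column.\<close>

lemma abs_det_3_le:
  fixes A :: "real^3^3"
  shows "\<bar>det A\<bar> \<le> 6 * (norm (column 1 A) * norm (column 2 A) * norm (column 3 A))"
proof -
  have entry: "\<bar>A $ i $ j\<bar> \<le> norm (column j A)" for i j
    using component_le_norm_cart[of "column j A" i] by (simp add: column_def)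
  have "\<bar>A $ i $ 1 * A $ j $ 2 * A $ k $ 3\<bar> \<le> norm (column 1 A) * norm (column 2 A) * norm (column 3 A)" for i j k
    unfolding abs_mult by (intro mult_mono entry) auto
  note this[of 1 2 3] this[of 3 1 2] this[of 2 3 1] this[of 1 3 2] this[of 2 1 3] this[of 3 2 1]
  then show ?thesis
    unfolding det_3 by (simp add: mult_ac abs_le_iff)
qed

text \<open>Bounded distortion keeps any one direction from being contracted much more than the
  others. If s^3 = K det A, then \<open>s\<close> bounds the operator norm; an orthonormal basis
  ending in \<open>n\<close> gives |det A| <= 6 s^2 |A n|, hence s^3 <= 6 |K| s^2 |A n|.\<close>

lemma norm_le_of_bounded_distortion:
  fixes A :: "real^3^3"
  assumes dist: "\<And>v. norm (A *v v) ^ 3 \<le> K * det A * norm v ^ 3" and n: "norm n = 1"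
  shows "norm (A *v v) \<le> 6 * \<bar>K\<bar> * norm (A *v n) * norm v"
proof -
  obtain R where R: "rotation_matrix R" "R *v axis 3 1 = n"
    using rotation_matrix_exists_basis[of n 3] n by auto
  then have R_norm: "norm (R *v x) = norm x" for x
    by (simp add: rotation_matrix_def orthogonal_transformation_matrix orthogonal_transformation_norm[of "(*v) R"])
  \<comment> \<open>The sign comes from testing \<open>dist\<close> with the unit vector
    \<open>n\<close>; it makes \<open>s\<close> nonnegative.\<close>
  have Kd: "0 \<le> K * det A"
    using order_trans[OF zero_le_power[OF norm_ge_zero] dist[of n]] n by simp
  define s where "s = root 3 (K * det A)"
  have s0: "s \<ge> 0" and s3: "s ^ 3 = K * det A"
    using Kd by (simp_all add: s_def odd_real_root_pow)
  \<comment> \<open>The rule used here compares powers with exponent \<open>Suc 2\<close>, that is,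
    cubes.\<close>
  have le: "norm (A *v v) \<le> s * norm v" for v
    by (rule power_le_imp_le_base[of _ 2]) (use dist[of v] s0 in \<open>simp_all add: power_mult_distrib s3\<close>)
  have col: "norm (column j (A ** R)) \<le> s" for j
    using le[of "R *v axis j 1"]
    by (simp add: R_norm matrix_vector_mul_assoc flip: matrix_vector_mult_basis)
  have col3: "column 3 (A ** R) = A *v n"
    by (simp add: R(2) flip: matrix_vector_mult_basis matrix_vector_mul_assoc)
  have "\<bar>det A\<bar> = \<bar>det (A ** R)\<bar>"
    using R(1) by (simp add: det_mul rotation_matrix_def)
  also have "\<dots> \<le> 6 * (norm (column 1 (A ** R)) * norm (column 2 (A ** R)) * norm (column 3 (A ** R)))"
    by (rule abs_det_3_le)
  also have "\<dots> \<le> 6 * (s * s * norm (A *v n))"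
    unfolding col3 using s0 by (intro mult_left_mono mult_mono col) auto
  finally have "\<bar>K\<bar> * \<bar>det A\<bar> \<le> \<bar>K\<bar> * (6 * (s * s * norm (A *v n)))"
    by (rule mult_left_mono) simp
  moreover have "s * (s * s) = \<bar>K\<bar> * \<bar>det A\<bar>"
    using s3 Kd by (simp add: power3_eq_cube mult.assoc flip: abs_mult)
  ultimately have "s * (s * s) \<le> (6 * \<bar>K\<bar> * norm (A *v n)) * (s * s)"
    by (simp add: mult_ac)
  then have "s \<le> 6 * \<bar>K\<bar> * norm (A *v n)"
    using s0 by (cases "s = 0") (auto dest: mult_right_le_imp_le)
  then show ?thesis
    using le[of v] by (meson mult_right_mono norm_ge_zero order_trans)
qed

text \<open>Since DP(x) x = m P(x), \<open>norm_le_of_bounded_distortion\<close> in the radial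
  direction bounds DP(x) by a multiple of |P(x)| / |x|. Along a segment from \<open>x0\<close> that
  avoids the origin this is a linear differential inequality with initial value 0.\<close>

lemma zero_of_degenerate_jacobian:
  fixes P :: "real^3 \<Rightarrow> real^3"
  assumes P: "\<And>k. homogeneous_harmonic m (\<lambda>x. P x $ k)" and "m > 0"
    and dist: "\<And>x v. norm (jacobian P (at x) *v v) ^ 3 \<le> K * det (jacobian P (at x)) * norm v ^ 3"
    and x0: "norm x0 = 1" and det0: "det (jacobian P (at x0)) = 0"
  shows "P y = 0"
proof -
  note diff = homogeneous_harmonic_differentiable[OF P]
  have hom: "P (t *\<^sub>R x) = t ^ m *\<^sub>R P x" for t x
    using P by (simp add: vec_eq_iff homogeneous_harmonic_def)
  have euler: "jacobian P (at x) *v x = m *\<^sub>R P x" for x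
  proof -
    have "(\<Sum>i\<in>UNIV. x $ i * partial_derivative i (\<lambda>x. P x $ k) x) = m * P x $ k" for k
      using P[of k] by (intro euler_relation diff) (simp add: homogeneous_harmonic_def)
    then show ?thesis
      by (simp add: vec_eq_iff matrix_vector_mult_def jacobian_nth[OF diff] mult.commute)
  qed
  have Px0: "P x0 = 0"
    using euler[of x0] dist[of x0 x0] det0 \<open>m > 0\<close> by (simp add: power_le_zero_eq mult_le_0_iff)
  have bound: "norm (jacobian P (at x) *v v) \<le> (6 * \<bar>K\<bar> * m * norm v / norm x) * norm (P x)"
    if "x \<noteq> 0" for x v
  proof -
    have "jacobian P (at x) *v (x /\<^sub>R norm x) = (m / norm x) *\<^sub>R P x"
      by (simp add: matrix_vector_mult_scaleR euler divide_inverse_commute)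
    then show ?thesis
      using norm_le_of_bounded_distortion[OF dist, of "x /\<^sub>R norm x" x v] that
      by (simp add: field_simps)
  qed
  define v where "v = y - x0"
  show ?thesis
  proof (cases "\<exists>t\<in>{0..1}. x0 + t *\<^sub>R v = 0")
    \<comment> \<open>The bound degenerates at the origin. If the segment meets it, \<open>y\<close>
      is a multiple of \<open>x0\<close>, and homogeneity gives the claim.\<close>
    case True
    then obtain t where t: "t \<in> {0..1}" "(1 - t) *\<^sub>R x0 + t *\<^sub>R y = 0"
      by (auto simp: v_def algebra_simps)
    then have "t \<noteq> 0" using x0 by auto
    have "y = (1 / t) *\<^sub>R (t *\<^sub>R y)" using \<open>t \<noteq> 0\<close> by simp
    also have "t *\<^sub>R y = (t - 1) *\<^sub>R x0"
      using t(2) by (simp add: scaleR_left_diff_distrib eq_neg_iff_add_eq_0 algebra_simps)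
    finally have "y = (1 / t * (t - 1)) *\<^sub>R x0" by simp
    then show ?thesis by (simp only: hom Px0 scaleR_zero_right)
  next
    case False
    \<comment> \<open>By compactness the segment keeps a distance \<delta> > 0 from the origin,
      which makes the Gronwall constant uniform in t.\<close>
    have "continuous_on {0..1} (\<lambda>t. norm (x0 + t *\<^sub>R v))"
      by (intro continuous_intros)
    moreover have "{0..1::real} \<noteq> {}" by simp
    ultimately obtain t0 where t0: "t0 \<in> {0..1}"
      "\<And>t. t \<in> {0..1} \<Longrightarrow> norm (x0 + t0 *\<^sub>R v) \<le> norm (x0 + t *\<^sub>R v)"
      using continuous_attains_inf[OF compact_Icc] by blast
    define \<delta> where "\<delta> = norm (x0 + t0 *\<^sub>R v)"
    have "\<delta> > 0" using False t0(1) by (auto simp: \<delta>_def)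
    define \<gamma> where "\<gamma> = (\<lambda>t. P (x0 + t *\<^sub>R v))"
    have "\<gamma> 1 = 0"
    proof (rule gronwall_zero[where C = "6 * \<bar>K\<bar> * m * norm v / \<delta>"])
      show "(\<gamma> has_vector_derivative jacobian P (at (x0 + t *\<^sub>R v)) *v v) (at t)" for t
      proof -
        have "((\<lambda>t. x0 + t *\<^sub>R v) has_derivative (\<lambda>s. s *\<^sub>R v)) (at t)"
          by (auto intro!: derivative_eq_intros)
        from has_derivative_compose[OF this has_derivative_jacobian[OF diff]] show ?thesis
          by (simp add: \<gamma>_def has_vector_derivative_def matrix_vector_mult_scaleR)
      qed
      show "norm (jacobian P (at (x0 + t *\<^sub>R v)) *v v) \<le> (6 * \<bar>K\<bar> * m * norm v / \<delta>) * norm (\<gamma> t)"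
        if "t \<in> {0..1}" for t
      proof -
        have "x0 + t *\<^sub>R v \<noteq> 0" using False that by auto
        then have "norm (jacobian P (at (x0 + t *\<^sub>R v)) *v v)
            \<le> (6 * \<bar>K\<bar> * m * norm v / norm (x0 + t *\<^sub>R v)) * norm (\<gamma> t)"
          unfolding \<gamma>_def by (rule bound)
        also have "\<dots> \<le> (6 * \<bar>K\<bar> * m * norm v / \<delta>) * norm (\<gamma> t)"
          using t0(2)[OF that] \<open>\<delta> > 0\<close>
          by (intro mult_right_mono divide_left_mono mult_pos_pos) (auto simp: \<delta>_def)
        finally show ?thesis .
      qed
      show "\<gamma> 0 = 0" by (simp add: \<gamma>_def Px0)
    qed
    then show ?thesis by (simp add: \<gamma>_def v_def)
  qed
qed

section \<open>Weak differentials of smooth maps\<close>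

text \<open>The regularity part of \<open>test_function\<close>, separated from the support
  condition.\<close>

definition continuously_differentiable :: "(real^'n::finite \<Rightarrow> real) \<Rightarrow> bool" where
  "continuously_differentiable f \<longleftrightarrow>
     (\<forall>x. f differentiable at x) \<and> (\<forall>i. continuous_on UNIV (partial_derivative i f))"

lemma continuously_differentiableD:
  assumes "continuously_differentiable f"
  shows "f differentiable at x" "continuous_on S (partial_derivative i f)" "continuous_on S f"
proof -
  show *: "f differentiable at x" for x
    using assms by (auto simp: continuously_differentiable_def)
  show "continuous_on S (partial_derivative i f)"
    using assms by (auto simp: continuously_differentiable_def intro: continuous_on_subset)
  show "continuous_on S f"
    by (meson * continuous_at_imp_continuous_on differentiable_imp_continuous_within)
qed

lemma continuously_differentiable_polynomial:
  "real_polynomial_function p \<Longrightarrow> continuously_differentiable p"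
  by (simp add: continuously_differentiable_def differentiable_at_real_polynomial_function
      continuous_real_polynomial_function real_polynomial_function_partial_derivative)

lemma continuously_differentiable_mult:
  assumes "continuously_differentiable f" "continuously_differentiable g"
  shows "continuously_differentiable (\<lambda>x. f x * g x)"
  unfolding continuously_differentiable_def
  using continuously_differentiableD[OF assms(1)] continuously_differentiableD[OF assms(2)]
  by (auto simp: partial_derivative_mult intro!: continuous_intros)

lemma continuously_differentiable_prod:
  assumes "finite A" "\<And>a. a \<in> A \<Longrightarrow> continuously_differentiable (f a)"
  shows "continuously_differentiable (\<lambda>x. \<Prod>a\<in>A. f a x)"
  using assms
  by (induction A rule: finite_induct)
     (auto simp: continuously_differentiable_mult continuously_differentiable_polynomial
       real_polynomial_function.intros(2))

text \<open>The conditions on \<open>F\<close> are confined to the values of \<open>f\<close>, so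
  that \<open>F\<close> may have a pole elsewhere, as n s / (1 + n s) has at s = -1/n.\<close>

lemma continuously_differentiable_compose:
  assumes f: "continuously_differentiable f"
    and F: "\<And>x. (F has_real_derivative F' (f x)) (at (f x))"
    and F': "continuous_on S F'" "range f \<subseteq> S"
  shows "continuously_differentiable (\<lambda>x. F (f x))"
proof -
  note D = continuously_differentiableD[OF f]
  have der: "((\<lambda>x. F (f x)) has_derivative
      (\<lambda>v. F' (f x) * (\<Sum>i\<in>UNIV. v $ i * partial_derivative i f x))) (at x)" for x
    by (rule has_derivative_compose[OF has_derivative_partial_derivatives[OF D(1)]
          has_field_derivative_imp_has_derivative[OF F]])
  have "partial_derivative i (\<lambda>x. F (f x)) = (\<lambda>x. F' (f x) * partial_derivative i f x)" for i
    by (rule ext, subst partial_derivative_eq[OF der])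
       (simp add: axis_def if_distrib[of "\<lambda>u. u * _"] cong: if_cong)
  moreover have "continuous_on UNIV (\<lambda>x. F' (f x))"
    by (rule continuous_on_compose2[OF F'(1) D(3) F'(2)])
  ultimately show ?thesis
    unfolding continuously_differentiable_def using der D(2)
    by (auto simp: differentiable_def intro!: continuous_intros)
qed

section \<open>Test functions and integration by parts\<close>

lemma test_function_iff:
  "test_function UNIV \<phi> \<longleftrightarrow> continuously_differentiable \<phi> \<and> compact (closure {x. \<phi> x \<noteq> 0})"
  by (auto simp: test_function_def continuously_differentiable_def)

lemma partial_derivative_outside_support:
  fixes \<phi> :: "real^'n::finite \<Rightarrow> real"
  assumes "x \<notin> closure {x. \<phi> x \<noteq> 0}"
  shows "partial_derivative i \<phi> x = 0"
proof -
  have "(\<phi> has_derivative (\<lambda>_. 0)) (at x)"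
  proof (rule has_derivative_transform_within_open[OF has_derivative_const])
    show "open (- closure {x. \<phi> x \<noteq> 0})" by auto
    show "0 = \<phi> y" if "y \<in> - closure {x. \<phi> x \<noteq> 0}" for y
      using that closure_subset[of "{x. \<phi> x \<noteq> 0}"] by auto
  qed (use assms in auto)
  from partial_derivative_eq[OF this] show ?thesis .
qed

lemma integrable_compact_support:
  fixes f :: "'a::euclidean_space \<Rightarrow> real"
  assumes "continuous_on UNIV f" "compact S" "\<And>x. x \<notin> S \<Longrightarrow> f x = 0"
  shows "integrable lborel f"
proof -
  have "integrable lborel (\<lambda>x. indicator S x *\<^sub>R f x)"
    using assms by (intro borel_integrable_compact) (auto intro: continuous_on_subset)
  moreover have "(\<lambda>x. indicator S x *\<^sub>R f x) = f"
    using assms(3) by (auto simp: fun_eq_iff indicator_def)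
  ultimately show ?thesis by simp
qed

text \<open>By translation invariance the difference quotients have integral \<open>0\<close>; they are dominated
  since the derivative is bounded.\<close>

lemma integral_partial_derivative_test_function:
  fixes \<psi> :: "real^'n::finite \<Rightarrow> real"
  assumes "test_function UNIV \<psi>"
  shows "(LINT x|lborel. partial_derivative j \<psi> x) = 0"
proof -
  define S where "S = closure {x. \<psi> x \<noteq> 0}"
  define D where "D = partial_derivative j \<psi>"
  have C1: "continuously_differentiable \<psi>" and S: "compact S"
    using assms by (auto simp: test_function_iff S_def)
  note d = continuously_differentiableD[OF C1]
  have cD: "continuous_on A D" for A using d by (simp add: D_def)
  have D0: "D x = 0" if "x \<notin> S" for x
    using that partial_derivative_outside_support by (auto simp: D_def S_def)
  have \<psi>0: "\<psi> x = 0" if "x \<notin> S" for x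
    using that closure_subset[of "{x. \<psi> x \<noteq> 0}"] by (auto simp: S_def)
  obtain B where B: "B > 0" "\<And>x. x \<in> S \<Longrightarrow> \<bar>D x\<bar> \<le> B"
    using compact_imp_bounded[OF compact_continuous_image[OF cD S]]
    by (auto simp: bounded_pos)
  have DB: "\<bar>D x\<bar> \<le> B" for x using B D0 by (cases "x \<in> S") auto
  obtain r where r: "\<And>x. x \<in> S \<Longrightarrow> norm x \<le> r"
    using compact_imp_bounded[OF S] by (auto simp: bounded_iff)
  define e :: "real^'n" where "e = axis j 1"
  have norm_e: "norm e = 1" by (simp add: e_def)
  have line: "((\<lambda>t. \<psi> (x + t *\<^sub>R e)) has_real_derivative D (x + t *\<^sub>R e)) (at t)" for x t
  proof -
    have "(\<Sum>i\<in>UNIV. e $ i * f i) = f j" for f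
      by (simp add: e_def axis_def if_distrib[of "\<lambda>u. u * _"] cong: if_cong)
    then show ?thesis
      using has_real_derivative_along_line[OF d(1), where x = x and t = t and v = e] by (simp add: D_def)
  qed
  define q where "q n x = (\<psi> (x + inverse (Suc n) *\<^sub>R e) - \<psi> x) * Suc n" for n x
  have int_\<psi>: "integrable lborel \<psi>"
    using integrable_compact_support[OF d(3) S \<psi>0] .
  have shift: "integrable lborel (\<lambda>x. \<psi> (x + c)) \<and> (LINT x|lborel. \<psi> (x + c)) = (LINT x|lborel. \<psi> x)" for c
  proof -
    have m: "\<psi> \<in> borel_measurable borel"
      using d(3) by (rule borel_measurable_continuous_onI)
    have "integrable (distr lborel borel ((+) c)) \<psi>"
      using int_\<psi> by (simp add: lborel_distr_plus)
    moreover have "(LINT x|distr lborel borel ((+) c). \<psi> x) = (LINT x|lborel. \<psi> x)"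
      by (simp add: lborel_distr_plus)
    ultimately show ?thesis
      using m by (simp add: integrable_distr_eq integral_distr add.commute)
  qed
  have q_int: "integral\<^sup>L lborel (q n) = 0" for n
  proof -
    have "integral\<^sup>L lborel (q n) =
        (LINT x|lborel. \<psi> (x + inverse (Suc n) *\<^sub>R e) - \<psi> x) * Suc n"
      unfolding q_def by (rule integral_mult_left_zero)
    also have "(LINT x|lborel. \<psi> (x + inverse (Suc n) *\<^sub>R e) - \<psi> x) = 0"
      using shift int_\<psi> by (subst Bochner_Integration.integral_diff) auto
    finally show ?thesis by simp
  qed
  \<comment> \<open>By the mean value theorem the quotients are bounded by \<open>B\<close>. The
    step 1/(n + 1) is at most 1 and the support lies in the ball of radius \<open>r\<close>, so they
    vanish outside the ball of radius r + 1.\<close>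
  have "(\<lambda>n. integral\<^sup>L lborel (q n)) \<longlonglongrightarrow> integral\<^sup>L lborel D"
  proof (rule integral_dominated_convergence[where w = "\<lambda>x. B * indicator (cball 0 (r + 1)) x"])
    show "D \<in> borel_measurable lborel"
      using borel_measurable_continuous_onI[OF cD] by simp
    show "q n \<in> borel_measurable lborel" for n
      unfolding q_def using shift int_\<psi>
      by (intro borel_measurable_times borel_measurable_diff borel_measurable_const)
         (auto dest: borel_measurable_integrable)
    show "integrable lborel (\<lambda>x. B * indicator (cball 0 (r + 1)) x)"
      by (intro integrable_mult_right integrable_real_indicator) (use emeasure_bounded_finite[OF bounded_cball, of 0 "r + 1"] in auto)
    show "AE x in lborel. (\<lambda>n. q n x) \<longlonglongrightarrow> D x"
    proof (intro AE_I2)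
      fix x
      have "((\<lambda>h. (\<psi> (x + h *\<^sub>R e) - \<psi> x) / h) \<longlongrightarrow> D x) (at 0)"
        using line[of x 0] by (simp add: DERIV_def)
      moreover have "filterlim (\<lambda>n. inverse (real (Suc n))) (at 0) sequentially"
        unfolding filterlim_at using LIMSEQ_inverse_real_of_nat by auto
      ultimately have "((\<lambda>n. (\<psi> (x + inverse (real (Suc n)) *\<^sub>R e) - \<psi> x) / inverse (real (Suc n))) \<longlongrightarrow> D x) sequentially"
        by (rule filterlim_compose)
      then show "(\<lambda>n. q n x) \<longlonglongrightarrow> D x" by (simp add: q_def divide_inverse)
    qed
    show "AE x in lborel. norm (q n x) \<le> B * indicator (cball 0 (r + 1)) x" for n
    proof (intro AE_I2)
      fix x
      define h where "h = inverse (real (Suc n))"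
      have h: "0 < h" "h \<le> 1" by (auto simp: h_def divide_simps)
      obtain z where "\<psi> (x + h *\<^sub>R e) - \<psi> (x + 0 *\<^sub>R e) = (h - 0) * D (x + z *\<^sub>R e)"
        using MVT2[OF h(1) line[of x]] by blast
      then have "q n x = D (x + z *\<^sub>R e)"
        using h by (simp add: q_def flip: h_def) (simp add: h_def)
      then have le: "\<bar>q n x\<bar> \<le> B" using DB by simp
      have "q n x = 0" if "norm x > r + 1"
      proof -
        have "norm (x + h *\<^sub>R e) \<ge> norm x - norm (h *\<^sub>R e)"
          by (metis add_diff_cancel norm_triangle_ineq2 norm_minus_commute add.commute diff_add_cancel norm_diff_ineq)
        then have "norm (x + h *\<^sub>R e) > r" using that h norm_e by auto
        then have "x + h *\<^sub>R e \<notin> S" "x \<notin> S"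
          using r that by force+
        then show ?thesis using \<psi>0 unfolding q_def h_def[symmetric] by simp
      qed
      then show "norm (q n x) \<le> B * indicator (cball 0 (r + 1)) x"
        using le by (auto simp: indicator_def)
    qed
  qed
  then have "(\<lambda>n::nat. 0) \<longlonglongrightarrow> integral\<^sup>L lborel D" by (simp add: q_int)
  then show ?thesis using LIMSEQ_unique[OF tendsto_const] unfolding D_def by metis
qed

lemma test_function_mult:
  assumes "continuously_differentiable f" "test_function UNIV \<phi>"
  shows "test_function UNIV (\<lambda>x. f x * \<phi> x)"
proof -
  have "closure {x. f x * \<phi> x \<noteq> 0} \<subseteq> closure {x. \<phi> x \<noteq> 0}"
    by (intro closure_mono) auto
  then have "compact (closure {x. f x * \<phi> x \<noteq> 0})"
    using assms(2) compact_Int_closed[of "closure {x. \<phi> x \<noteq> 0}" "closure {x. f x * \<phi> x \<noteq> 0}"]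
    by (simp add: test_function_iff Int_absorb1)
  then show ?thesis
    using assms by (simp add: test_function_iff continuously_differentiable_mult)
qed

text \<open>The product of \<open>f\<close> and \<phi> is again a test function, so its partial
  derivative has integral 0, and the product rule splits this integral.\<close>

lemma integral_by_parts_test_function:
  fixes f :: "real^'n::finite \<Rightarrow> real"
  assumes f: "continuously_differentiable f" and \<phi>: "test_function UNIV \<phi>"
  shows "(LINT x|lebesgue. f x * partial_derivative j \<phi> x) =
    - (LINT x|lebesgue. partial_derivative j f x * \<phi> x)"
proof -
  have C1: "continuously_differentiable \<phi>" and S: "compact (closure {x. \<phi> x \<noteq> 0})"
    using \<phi> by (auto simp: test_function_iff)
  note df = continuously_differentiableD[OF f] and d\<phi> = continuously_differentiableD[OF C1]
  have c: "continuous_on UNIV (\<lambda>x. f x * partial_derivative j \<phi> x)"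
    "continuous_on UNIV (\<lambda>x. partial_derivative j f x * \<phi> x)"
    by (rule continuous_on_mult df d\<phi>)+
  have \<phi>0: "\<phi> x = 0" if "x \<notin> closure {x. \<phi> x \<noteq> 0}" for x
    using that closure_subset[of "{x. \<phi> x \<noteq> 0}"] by auto
  have i1: "integrable lborel (\<lambda>x. f x * partial_derivative j \<phi> x)"
  proof (rule integrable_compact_support[OF c(1) S])
    fix x assume "x \<notin> closure {x. \<phi> x \<noteq> 0}"
    from partial_derivative_outside_support[OF this] show "f x * partial_derivative j \<phi> x = 0"
      by (simp only: mult_zero_right)
  qed
  have i2: "integrable lborel (\<lambda>x. partial_derivative j f x * \<phi> x)"
  proof (rule integrable_compact_support[OF c(2) S])
    fix x assume "x \<notin> closure {x. \<phi> x \<noteq> 0}"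
    from \<phi>0[OF this] show "partial_derivative j f x * \<phi> x = 0"
      by (simp only: mult_zero_right)
  qed
  have "0 = (LINT x|lborel. f x * partial_derivative j \<phi> x + partial_derivative j f x * \<phi> x)"
    using integral_partial_derivative_test_function[OF test_function_mult[OF f \<phi>], of j]
    by (simp only: partial_derivative_mult[OF df(1) d\<phi>(1)])
  also have "\<dots> = (LINT x|lborel. f x * partial_derivative j \<phi> x) + (LINT x|lborel. partial_derivative j f x * \<phi> x)"
    using i1 i2 by (rule Bochner_Integration.integral_add)
  finally show ?thesis
    by (simp add: i1 i2 borel_measurable_integrable[THEN integral_completion])
qed

text \<open>Squaring removes the corner of the positive part at 0; this is the profile of the C^1
  bump function in \<open>du_Bois_Reymond\<close>.\<close>

lemma has_real_derivative_max_0_power2: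
  "((\<lambda>s. (max 0 s)\<^sup>2) has_real_derivative 2 * max 0 s) (at s)"
proof -
  consider "s > 0" | "s < 0" | "s = 0" by linarith
  then show ?thesis
  proof cases
    case 1
    show ?thesis
      by (rule has_field_derivative_transform_within_open[of "\<lambda>s. s\<^sup>2" _ _ "{0<..}"])
         (use 1 in \<open>auto intro!: derivative_eq_intros\<close>)
  next
    case 2
    show ?thesis
      by (rule has_field_derivative_transform_within_open[of "\<lambda>s. 0" _ _ "{..<0}"])
         (use 2 in \<open>auto intro!: derivative_eq_intros\<close>)
  next
    case 3
    have "((\<lambda>h. (max 0 h)\<^sup>2 / h) \<longlongrightarrow> 0) (at (0::real))"
    proof (rule Lim_null_comparison)
      show "\<forall>\<^sub>F h in at (0::real). norm ((max 0 h)\<^sup>2 / h) \<le> \<bar>h\<bar>"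
        by (intro always_eventually) (auto simp: max_def power2_eq_square)
      show "((\<lambda>h. \<bar>h\<bar>) \<longlongrightarrow> 0) (at (0::real))"
        by (rule tendsto_rabs_zero) (rule tendsto_ident_at)
    qed
    then show ?thesis by (simp add: 3 DERIV_def)
  qed
qed

section \<open>The fundamental lemma of the calculus of variations\<close>

lemma integrable_mult_test_function:
  fixes E :: "real^'n::finite \<Rightarrow> real"
  assumes E: "E \<in> borel_measurable lebesgue" "\<And>S. compact S \<Longrightarrow> set_integrable lebesgue S E"
    and \<phi>: "continuous_on UNIV \<phi>" "compact (closure {x. \<phi> x \<noteq> 0})"
  shows "integrable lebesgue (\<lambda>x. E x * \<phi> x)"
proof -
  let ?S = "closure {x. \<phi> x \<noteq> 0}"
  obtain B where B: "B > 0" "\<And>x. x \<in> ?S \<Longrightarrow> \<bar>\<phi> x\<bar> \<le> B"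
    using compact_imp_bounded[OF compact_continuous_image[OF continuous_on_subset[OF \<phi>(1)] \<phi>(2)]]
    by (auto simp: bounded_pos)
  have "integrable lebesgue (\<lambda>x. B * (indicator ?S x *\<^sub>R E x))"
    using E(2)[OF \<phi>(2)] by (auto simp: set_integrable_def)
  then show ?thesis
  proof (rule Bochner_Integration.integrable_bound)
    have "\<phi> \<in> borel_measurable lebesgue"
      using borel_measurable_continuous_onI[OF \<phi>(1)] by (simp add: measurable_completion)
    then show "(\<lambda>x. E x * \<phi> x) \<in> borel_measurable lebesgue"
      using E(1) by auto
    have "\<bar>E x * \<phi> x\<bar> \<le> \<bar>B * (indicator ?S x *\<^sub>R E x)\<bar>" for x
    proof (cases "x \<in> ?S")
      case True
      then have "\<bar>E x\<bar> * \<bar>\<phi> x\<bar> \<le> \<bar>E x\<bar> * B" by (intro mult_left_mono B) auto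
      then show ?thesis using True B by (simp add: abs_mult mult.commute)
    next
      case False
      then have "\<phi> x = 0" using closure_subset[of "{x. \<phi> x \<noteq> 0}"] by auto
      then show ?thesis by simp
    qed
    then show "AE x in lebesgue. norm (E x * \<phi> x) \<le> norm (B * (indicator ?S x *\<^sub>R E x))"
      by (intro AE_I2) simp
  qed
qed

text \<open>The indicator of an open box is the limit of the test functions \<open>n \<theta> / (1 + n \<theta>)\<close>, where
  \<open>\<theta>\<close> is a nonnegative function of class \<open>C\<^sup>1\<close> that is positive exactly on the box. Hence \<open>E\<close> has
  integral zero over all boxes.\<close>

lemma du_Bois_Reymond:
  fixes E :: "real^'n::finite \<Rightarrow> real"
  assumes E: "E \<in> borel_measurable lebesgue" "\<And>S. compact S \<Longrightarrow> set_integrable lebesgue S E"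
    and test: "\<And>\<phi>. test_function UNIV \<phi> \<Longrightarrow> (LINT x|lebesgue. E x * \<phi> x) = 0"
  shows "AE x in lebesgue. E x = 0"
proof -
  have int0: "integral (cbox a b) E = 0" for a b
  proof (cases "\<forall>i. a $ i < b $ i")
    \<comment> \<open>A degenerate box has empty interior, and integrals over the open and the
      closed box agree.\<close>
    case False
    then have "box a b = {}" by (auto simp: interval_eq_empty_cart not_less)
    then show ?thesis using integral_open_interval[of a b E] by simp
  next
    case True
    \<comment> \<open>As a_i < b_i, the two factors cannot both be negative, so their product is
      positive exactly for a_i < x_i < b_i.\<close>
    define \<theta> where "\<theta> x = (\<Prod>i\<in>UNIV. (max 0 ((x $ i - a $ i) * (b $ i - x $ i)))\<^sup>2)" for x
    have \<theta>_nonneg: "\<theta> x \<ge> 0" for x by (simp add: \<theta>_def prod_nonneg)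
    have pos_iff: "0 < (x $ i - a $ i) * (b $ i - x $ i) \<longleftrightarrow> a $ i < x $ i \<and> x $ i < b $ i" for x i
      using True[rule_format, of i] by (auto simp: zero_less_mult_iff)
    have \<theta>_pos: "\<theta> x \<noteq> 0 \<longleftrightarrow> x \<in> box a b" for x
    proof -
      have "(max 0 s)\<^sup>2 \<noteq> 0 \<longleftrightarrow> 0 < s" for s :: real by (auto simp: max_def)
      then show ?thesis by (simp only: \<theta>_def prod_zero_iff[OF finite] mem_box_cart pos_iff[symmetric]) simp
    qed
    have "real_polynomial_function (\<lambda>x::real^'n. (x $ i - a $ i) * (b $ i - x $ i))" for i
      by (intro real_polynomial_function.intros(4) real_polynomial_function_diff
          real_polynomial_function.intros(1)[OF bounded_linear_vec_nth] real_polynomial_function.intros(2))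
    then have "continuously_differentiable (\<lambda>x. (max 0 ((x $ i - a $ i) * (b $ i - x $ i)))\<^sup>2)" for i
      by (intro continuously_differentiable_compose[where F = "\<lambda>s. (max 0 s)\<^sup>2" and F' = "\<lambda>s. 2 * max 0 s" and S = UNIV]
          continuously_differentiable_polynomial has_real_derivative_max_0_power2)
         (auto intro!: continuous_intros)
    then have C1\<theta>: "continuously_differentiable \<theta>"
      unfolding \<theta>_def by (rule continuously_differentiable_prod[OF finite])
    define \<phi> where "\<phi> n x = real n * \<theta> x / (1 + real n * \<theta> x)" for n x
    have denom: "1 + real n * \<theta> x > 0" for n x
      using \<theta>_nonneg[of x] by (simp add: add_pos_nonneg)
    have supp: "closure {x. \<phi> n x \<noteq> 0} \<subseteq> cbox a b" for n
      by (rule closure_minimal) (use \<theta>_pos box_subset_cbox in \<open>auto simp: \<phi>_def\<close>)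
    have C1\<phi>: "continuously_differentiable (\<phi> n)" for n
      unfolding \<phi>_def
    proof (rule continuously_differentiable_compose[OF C1\<theta>, where F = "\<lambda>s. real n * s / (1 + real n * s)"
            and F' = "\<lambda>s. real n / (1 + real n * s)\<^sup>2" and S = "{0..}"])
      show "((\<lambda>s. real n * s / (1 + real n * s)) has_real_derivative real n / (1 + real n * \<theta> x)\<^sup>2) (at (\<theta> x))" for x
        using denom[of n x] by (auto intro!: derivative_eq_intros simp: power2_eq_square algebra_simps)
      have "1 + real n * s \<noteq> 0" if "s \<ge> 0" for s
        using that by (smt (verit) mult_nonneg_nonneg of_nat_0_le_iff)
      then show "continuous_on {0..} (\<lambda>s. real n / (1 + real n * s)\<^sup>2)"
        by (intro continuous_intros) auto
      show "range \<theta> \<subseteq> {0..}" using \<theta>_nonneg by auto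
    qed
    have tf: "test_function UNIV (\<phi> n)" for n
      using C1\<phi> compact_Int_closed[OF compact_cbox closed_closure, of a b "{x. \<phi> n x \<noteq> 0}"] supp[of n]
      by (simp add: test_function_iff Int_absorb1)
    have "(\<lambda>n. LINT x|lebesgue. E x * \<phi> n x) \<longlonglongrightarrow> (LINT x|lebesgue. indicator (box a b) x *\<^sub>R E x)"
    proof (rule integral_dominated_convergence[where w = "\<lambda>x. \<bar>indicator (cbox a b) x *\<^sub>R E x\<bar>"])
      show "(\<lambda>x. indicator (box a b) x *\<^sub>R E x) \<in> borel_measurable lebesgue"
        using E(1) by (intro borel_measurable_scaleR borel_measurable_indicator) auto
      show "(\<lambda>x. E x * \<phi> n x) \<in> borel_measurable lebesgue" for n
        using borel_measurable_continuous_onI[OF continuously_differentiableD(3)[OF C1\<phi>]] E(1)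
        by (intro borel_measurable_times) (simp_all add: measurable_completion)
      show "integrable lebesgue (\<lambda>x. \<bar>indicator (cbox a b) x *\<^sub>R E x\<bar>)"
        using E(2)[OF compact_cbox] by (simp add: set_integrable_def)
      show "AE x in lebesgue. (\<lambda>n. E x * \<phi> n x) \<longlonglongrightarrow> indicator (box a b) x *\<^sub>R E x"
      proof (intro AE_I2)
        fix x
        show "(\<lambda>n. E x * \<phi> n x) \<longlonglongrightarrow> indicator (box a b) x *\<^sub>R E x"
        proof (cases "x \<in> box a b")
          case True
          then have "\<theta> x > 0" using \<theta>_pos[of x] \<theta>_nonneg[of x] by simp
          then have "(\<lambda>n. E x * \<phi> n x) \<longlonglongrightarrow> E x * 1"
            unfolding \<phi>_def by (intro tendsto_mult tendsto_const) real_asymp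
          then show ?thesis using True by simp
        next
          case False
          then have "\<theta> x = 0" using \<theta>_pos[of x] by simp
          then show ?thesis using False by (simp add: \<phi>_def)
        qed
      qed
      show "AE x in lebesgue. norm (E x * \<phi> n x) \<le> \<bar>indicator (cbox a b) x *\<^sub>R E x\<bar>" for n
      proof (intro AE_I2)
        fix x
        show "norm (E x * \<phi> n x) \<le> \<bar>indicator (cbox a b) x *\<^sub>R E x\<bar>"
        proof (cases "x \<in> cbox a b")
          case True
          have "\<bar>\<phi> n x\<bar> \<le> 1"
            using denom[of n x] \<theta>_nonneg[of x] by (simp add: \<phi>_def)
          then have "\<bar>E x\<bar> * \<bar>\<phi> n x\<bar> \<le> \<bar>E x\<bar> * 1" by (intro mult_left_mono) auto
          then show ?thesis using True by (simp add: abs_mult)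
        next
          case False
          then have "\<phi> n x = 0" using supp[of n] closure_subset[of "{x. \<phi> n x \<noteq> 0}"] by auto
          then show ?thesis by simp
        qed
      qed
    qed
    then have "(\<lambda>n::nat. 0) \<longlonglongrightarrow> (LINT x:box a b|lebesgue. E x)"
      by (simp only: test[OF tf] set_lebesgue_integral_def)
    then have "(LINT x:box a b|lebesgue. E x) = 0"
      by (rule LIMSEQ_unique) (rule tendsto_const)
    moreover have "set_integrable lebesgue (box a b) E"
      by (rule set_integrable_subset[OF E(2)[OF compact_cbox, of a b]]) (use box_subset_cbox in auto)
    ultimately show ?thesis
      using set_lebesgue_integral_eq_integral(2)[of "box a b" E] integral_open_interval[of a b E] by simp
  qed
  \<comment> \<open>Lebesgue differentiation: off a negligible set, \<open>E x\<close> is the limit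
    of averages over shrinking cubes with corner \<open>x\<close>, and these averages are all
    0.\<close>
  have "E integrable_on cbox a b" for a b
    using set_lebesgue_integral_eq_integral(1)[OF E(2)[OF compact_cbox]] .
  then obtain N where N: "negligible N"
    "\<And>x e. x \<notin> N \<Longrightarrow> 0 < e \<Longrightarrow> \<exists>d>0. \<forall>h. 0 < h \<and> h < d \<longrightarrow>
      norm (integral (cbox x (x + h *\<^sub>R One)) E /\<^sub>R h ^ DIM(real^'n) - E x) < e"
    using integrable_ccontinuous_explicit[of E] by blast
  have "E x = 0" if x: "x \<notin> N" for x
  proof (rule ccontr)
    assume "E x \<noteq> 0"
    then have "\<exists>d>0. \<forall>h. 0 < h \<and> h < d \<longrightarrow> norm (0 /\<^sub>R h ^ DIM(real^'n) - E x) < \<bar>E x\<bar>"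
      using N(2)[OF x, of "\<bar>E x\<bar>"] unfolding int0 by simp
    then obtain d where "d > 0"
      and d: "\<forall>h. 0 < h \<and> h < d \<longrightarrow> norm (0 /\<^sub>R h ^ DIM(real^'n) - E x) < \<bar>E x\<bar>"
      by blast
    show False using d[rule_format, of "d / 2"] \<open>d > 0\<close> by simp
  qed
  then have "{x. E x \<noteq> 0} \<subseteq> N" by auto
  then show ?thesis
    using N(1) negligible_iff_null_sets by (intro AE_I'[of N]) auto
qed

section \<open>Identification of the weak differential\<close>

lemma set_integrable_continuous_compact:
  fixes g :: "'a::euclidean_space \<Rightarrow> real"
  assumes "compact S" "continuous_on S g"
  shows "set_integrable lebesgue S g"
  using borel_integrable_compact[OF assms] unfolding set_integrable_def
  by (simp add: integrable_completion borel_measurable_integrable)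

text \<open>Weak and classical derivatives satisfy the same integration by parts formula, so
  \<open>du_Bois_Reymond\<close> applies to their difference, entry by entry.\<close>

lemma weak_differential_eq_jacobian:
  fixes f :: "real^'n::finite \<Rightarrow> real^'k::finite"
  assumes W: "has_W1p_loc_differential p UNIV f D" and "p > 0"
    and f: "\<And>k. continuously_differentiable (\<lambda>x. f x $ k)"
  shows "AE x in lebesgue. D x = (\<chi> k j. partial_derivative j (\<lambda>x. f x $ k) x)"
proof -
  have D: "D \<in> borel_measurable lebesgue"
    and Dp: "\<And>C. compact C \<Longrightarrow> set_integrable lebesgue C (\<lambda>x. norm (D x) ^ p)"
    using W by (auto simp: has_W1p_loc_differential_def locally_Lp_def set_borel_measurable_def)
  have "AE x in lebesgue. D x $ k $ j - partial_derivative j (\<lambda>x. f x $ k) x = 0" for k j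
  proof (rule du_Bois_Reymond)
    define g where "g = partial_derivative j (\<lambda>x. f x $ k)"
    have g: "continuous_on A g" for A
      unfolding g_def by (rule continuously_differentiableD[OF f])
    have gm: "g \<in> borel_measurable lebesgue"
      using borel_measurable_continuous_onI[OF g] by (simp add: measurable_completion)
    have Dm: "(\<lambda>x. D x $ k $ j) \<in> borel_measurable lebesgue"
      by (rule measurable_compose[OF D]) (intro borel_measurable_continuous_onI continuous_intros)
    \<comment> \<open>Local L^p bounds give local integrability because |D| <= 1 + |D|^p for p >
      0.\<close>
    have Di: "set_integrable lebesgue S (\<lambda>x. D x $ k $ j)" if "compact S" for S
    proof -
      have "set_integrable lebesgue S (\<lambda>x. 1 + norm (D x) ^ p)"
        using set_integrable_continuous_compact[OF that continuous_on_const] Dp[OF that]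
        by (rule set_integral_add)
      then show ?thesis
        unfolding set_integrable_def
      proof (rule Bochner_Integration.integrable_bound)
        show "(\<lambda>x. indicator S x *\<^sub>R D x $ k $ j) \<in> borel_measurable lebesgue"
          using that Dm by (intro borel_measurable_scaleR borel_measurable_indicator) (auto simp: compact_imp_closed)
        have "\<bar>D x $ k $ j\<bar> \<le> 1 + norm (D x) ^ p" for x
        proof -
          have "\<bar>D x $ k $ j\<bar> \<le> norm (D x)"
            by (meson Finite_Cartesian_Product.norm_nth_le component_le_norm_cart order_trans)
          also have "\<dots> \<le> 1 + norm (D x) ^ p"
          proof (cases "norm (D x) \<le> 1")
            case False
            then have "norm (D x) ^ 1 \<le> norm (D x) ^ p"
              using \<open>p > 0\<close> by (intro power_increasing) auto
            then show ?thesis by simp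
          qed (simp add: add_increasing2)
          finally show ?thesis .
        qed
        then show "AE x in lebesgue. norm (indicator S x *\<^sub>R D x $ k $ j) \<le>
            norm (indicator S x *\<^sub>R (1 + norm (D x) ^ p))"
          by (intro AE_I2) (auto simp: indicator_def intro: order_trans[OF _ abs_ge_self])
      qed
    qed
    have gi: "set_integrable lebesgue S g" if "compact S" for S
      by (rule set_integrable_continuous_compact) (use that g in auto)
    show "(\<lambda>x. D x $ k $ j - partial_derivative j (\<lambda>x. f x $ k) x) \<in> borel_measurable lebesgue"
      using gm Dm unfolding g_def by auto
    show "set_integrable lebesgue S (\<lambda>x. D x $ k $ j - partial_derivative j (\<lambda>x. f x $ k) x)" if "compact S" for S
      using Di[OF that] gi[OF that] unfolding g_def by (rule set_integral_diff)
    show "(LINT x|lebesgue. (D x $ k $ j - partial_derivative j (\<lambda>x. f x $ k) x) * \<phi> x) = 0"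
      if \<phi>: "test_function UNIV \<phi>" for \<phi>
    proof -
      have c\<phi>: "continuous_on UNIV \<phi>" "compact (closure {x. \<phi> x \<noteq> 0})"
        using \<phi> continuously_differentiableD(3) by (auto simp: test_function_iff)
      have "(LINT x|lebesgue. (D x $ k $ j - g x) * \<phi> x) =
          (LINT x|lebesgue. D x $ k $ j * \<phi> x) - (LINT x|lebesgue. g x * \<phi> x)"
        unfolding left_diff_distrib
        by (intro Bochner_Integration.integral_diff integrable_mult_test_function c\<phi> Dm Di gm gi)
      moreover have "(LINT x|lebesgue. f x $ k * partial_derivative j \<phi> x) = - (LINT x|lebesgue. D x $ k $ j * \<phi> x)"
        using W \<phi> by (simp add: has_W1p_loc_differential_def set_lebesgue_integral_def)
      ultimately show ?thesis
        using integral_by_parts_test_function[OF f \<phi>, of k j] by (simp add: g_def)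
    qed
  qed
  then have "AE x in lebesgue. \<forall>k\<in>UNIV. \<forall>j\<in>UNIV. D x $ k $ j - partial_derivative j (\<lambda>x. f x $ k) x = 0"
    by (intro AE_finite_allI finite)
  then show ?thesis by eventually_elim (simp add: vec_eq_iff)
qed

text \<open>The set where the inequality fails is open by continuity and negligible, hence
  empty.\<close>

lemma AE_le_imp_le:
  fixes g h :: "'a::euclidean_space \<Rightarrow> real"
  assumes ae: "AE x in lebesgue. g x \<le> h x" and "continuous_on UNIV g" "continuous_on UNIV h"
  shows "g x \<le> h x"
proof -
  have "open {x. h x < g x}"
    using assms(2,3) by (intro open_Collect_less)
  moreover have "negligible {x. h x < g x}"
    using ae by (simp add: completion.AE_iff_null_sets negligible_iff_null_sets AE_iff_null_sets not_le)
  ultimately have "{x. h x < g x} = {}"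
    using open_not_negligible by blast
  then show ?thesis by (auto simp: not_less)
qed

section \<open>Quasiregular harmonic mappings\<close>

text \<open>The operator norm is replaced by its action on a fixed \<open>v\<close>. Both sides are
  then continuous in \<open>x\<close>, and the inequality passes from almost every point to every
  point.\<close>

lemma bounded_distortion_of_quasiregular:
  fixes P :: "real^'n::finite \<Rightarrow> real^'n"
  assumes qr: "sense_preserving_quasiregular K UNIV P"
    and poly: "\<And>k. real_polynomial_function (\<lambda>x. P x $ k)"
  shows "0 \<le> det (jacobian P (at x))"
    and "norm (jacobian P (at x) *v v) ^ CARD('n) \<le> K * det (jacobian P (at x)) * norm v ^ CARD('n)"
proof -
  obtain D where W: "has_W1p_loc_differential CARD('n) UNIV P D"
    and D: "AE x in lebesgue. 0 \<le> det (D x)"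
      "AE x in lebesgue. onorm ((*v) (D x)) ^ CARD('n) \<le> K * det (D x)"
    using qr by (auto simp: sense_preserving_quasiregular_def)
  note jac = jacobian_nth[OF differentiable_at_real_polynomial_function[OF poly]]
  have "(\<chi> k j. partial_derivative j (\<lambda>x. P x $ k) x) = jacobian P (at x)" for x
    by (simp add: vec_eq_iff jac)
  then have eq: "AE x in lebesgue. D x = jacobian P (at x)"
    using weak_differential_eq_jacobian[OF W] continuously_differentiable_polynomial[OF poly] by simp
  note c = continuous_det_jacobian[OF poly]
  have "AE x in lebesgue. 0 \<le> det (jacobian P (at x))"
    using D(1) eq by eventually_elim simp
  then show "0 \<le> det (jacobian P (at x))"
    by (rule AE_le_imp_le) (auto intro: c)
  have "continuous_on UNIV (\<lambda>x. jacobian P (at x) *v v)"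
    unfolding matrix_vector_mult_def jac
    by (intro continuous_on_vec_lambda continuous_intros continuous_real_polynomial_function
        real_polynomial_function_partial_derivative poly)
  moreover have "AE x in lebesgue.
      norm (jacobian P (at x) *v v) ^ CARD('n) \<le> K * det (jacobian P (at x)) * norm v ^ CARD('n)"
    using D(2) eq
  proof eventually_elim
    case (elim x)
    have "norm (jacobian P (at x) *v v) ^ CARD('n) \<le> (onorm ((*v) (D x)) * norm v) ^ CARD('n)"
      using elim by (intro power_mono) (auto intro: onorm matrix_vector_mul_bounded_linear)
    also have "\<dots> \<le> K * det (D x) * norm v ^ CARD('n)"
      unfolding power_mult_distrib using elim by (intro mult_right_mono) auto
    finally show ?case using elim by simp
  qed
  ultimately show "norm (jacobian P (at x) *v v) ^ CARD('n) \<le> K * det (jacobian P (at x)) * norm v ^ CARD('n)"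
    by (intro AE_le_imp_le[where g = "\<lambda>x. norm (jacobian P (at x) *v v) ^ CARD('n)"
          and h = "\<lambda>x. K * det (jacobian P (at x)) * norm v ^ CARD('n)"])
       (auto intro!: continuous_intros c)
qed

text \<open>The Jacobian is nonnegative; a zero on the sphere would make the map vanish identically,
  so it is positive there and \<open>no_positive_jacobian\<close> applies.\<close>

lemma not_sense_preserving_quasiregular:
  fixes P :: "real^3 \<Rightarrow> real^3"
  assumes P: "\<And>k. homogeneous_harmonic m (\<lambda>x. P x $ k)" and "m > 1"
  shows "\<not> sense_preserving_quasiregular K UNIV P"
proof
  assume qr: "sense_preserving_quasiregular K UNIV P"
  then have nonconst: "\<not> P constant_on UNIV"
    by (simp add: sense_preserving_quasiregular_def)
  have poly: "real_polynomial_function (\<lambda>x. P x $ k)" for k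
    using P by (simp add: homogeneous_harmonic_def)
  note dist = bounded_distortion_of_quasiregular[OF qr poly, simplified]
  have "det (jacobian P (at x)) > 0" if "x \<in> sphere 0 1" for x
  proof (rule ccontr)
    assume "\<not> det (jacobian P (at x)) > 0"
    then have "det (jacobian P (at x)) = 0" using dist(1)[of x] by simp
    then have "P y = 0" for y
      using zero_of_degenerate_jacobian[OF P _ dist(2)] that \<open>m > 1\<close> by simp
    then show False using nonconst by (auto simp: constant_on_def)
  qed
  then show False by (rule no_positive_jacobian[OF P \<open>m > 1\<close>])
qed

text \<open>Turns composition with a reflection into multiplication by a matrix, which preserves
  homogeneous harmonic components.\<close>

lemma linear_reflection: "linear (reflection v)"
  by (rule linearI)
     (simp_all add: reflection_def inner_add_left algebra_simps add_divide_distrib)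

theorem theorem1p2:
  fixes m :: nat
  assumes "m > 1"
  shows "(\<nexists>P :: real^3 \<Rightarrow> real^3. homogeneous_harmonic_polynomial_mapping m P \<and>
             \<not> P constant_on UNIV \<and> quasiregular UNIV P) \<and>
         (\<nexists>P :: real^3 \<Rightarrow> real^3. homogeneous_harmonic_polynomial_mapping m P \<and>
             (\<forall>x\<in>sphere 0 1. det (jacobian P (at x)) > 0)) \<and>
         (\<nexists>P :: real^3 \<Rightarrow> real^3. homogeneous_harmonic_polynomial_mapping m P \<and>
             (\<forall>x\<in>sphere 0 1. det (jacobian P (at x)) < 0))"
proof (intro conjI notI; elim exE conjE)
  fix P :: "real^3 \<Rightarrow> real^3"
  assume P: "homogeneous_harmonic_polynomial_mapping m P" and "quasiregular UNIV P"
  then consider K where "sense_preserving_quasiregular K UNIV P"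
    | v K where "sense_preserving_quasiregular K UNIV (reflection v \<circ> P)"
    by (auto simp: quasiregular_def)
  then show False
  proof cases
    case 1
    then show False
      using not_sense_preserving_quasiregular[OF homogeneous_harmonic_component[OF P] assms] by simp
  next
    case 2
    have "reflection v \<circ> P = (\<lambda>x. matrix (reflection v) *v P x)"
      by (simp add: fun_eq_iff matrix_works linear_reflection)
    moreover have "\<not> sense_preserving_quasiregular K UNIV (\<lambda>x. matrix (reflection v) *v P x)"
      by (intro not_sense_preserving_quasiregular[where m = m] homogeneous_harmonic_matrix_vector_mult
          homogeneous_harmonic_component[OF P] assms)
    ultimately show False using 2 by simp
  qed
next
  fix P :: "real^3 \<Rightarrow> real^3"
  assume P: "homogeneous_harmonic_polynomial_mapping m P"
    and "\<forall>x\<in>sphere 0 1. det (jacobian P (at x)) > 0"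
  then show False
    by (intro no_positive_jacobian[OF homogeneous_harmonic_component[OF P] assms]) simp
next
  fix P :: "real^3 \<Rightarrow> real^3"
  assume P: "homogeneous_harmonic_polynomial_mapping m P"
    and neg: "\<forall>x\<in>sphere 0 1. det (jacobian P (at x)) < 0"
  \<comment> \<open>In odd dimension -1 has determinant -1, so passing from P to -P reverses the
    sign of the Jacobian. The factors \<open>mat 1\<close> below fit the source side of
    \<open>jacobian_matrix_comp\<close>.\<close>
  define B :: "real^3^3" where "B = - mat 1"
  have "det B = -1"
    by (simp add: B_def det_3 mat_def)
  moreover have "jacobian (\<lambda>x. B *v P (mat 1 *v x)) (at x) = B ** (jacobian P (at (mat 1 *v x)) ** mat 1)" for x
    by (intro jacobian_matrix_comp homogeneous_harmonic_differentiable[where m = m] homogeneous_harmonic_component[OF P])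
  ultimately have pos: "det (jacobian (\<lambda>x. B *v P x) (at x)) > 0" if "x \<in> sphere 0 1" for x
    using neg that by (simp add: det_mul)
  have "homogeneous_harmonic m (\<lambda>x. (B *v P x) $ k)" for k
    by (intro homogeneous_harmonic_matrix_vector_mult homogeneous_harmonic_component[OF P])
  then show False by (rule no_positive_jacobian[OF _ assms pos])
qed

end
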